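(* Let $t=m\tau$ be a discrete time with $t+\tau\le T$, let $(U(t),W(t))$ be the coefficient vectors of a solution of the fully implicit scheme at time $t$, and let $\phi_N^{(k)},\psi_N^{(k)}$, $k\ge0$, be the Newton iterates for this time step (defined in the context). Let $\epsilon_{tol}>0$ and assume that $\phi_N^{(0)}$ is chosen such that, for some $k_0\ge0$, $\|\phi_N^{(k+1)}-\phi_N^{(k)}\|_2<\epsilon_{tol}$ for all $k\ge k_0$. Let $$D_1:=D_1(\Omega,T,p,w_0)=c_{inv}^2\left(\epsilon_{tol}+e^{3T\|p\|_{1,\infty}}\|w_0\|_2\right)+2\|p\|_{1,\infty},$$ where $c_{inv}>0$ is a constant such that $|v|_{1,4}\le c_{inv}h^{-5/4}\|v\|_2$ for all $v\in X_N$. If $h<1$ and $$0<\tau\le\min\left\{\frac{1}{6\|p\|_{1,\infty}},\ \frac{h^2}{16\,c_{0,inv}\|W(t)\|_M},\ \frac{h^{5/2}}{2D_1}\right\},$$ then Newton's method converges to the unique solution $(U(t+\tau),W(t+\tau))$ of the fully implicit scheme at time $t+\tau$, i.e. $$\lim_{k\to\infty}\phi_N^{(k)}=\phi_N\qquad\text{and}\qquad\lim_{k\to\infty}\psi_N^{(k)}=\psi_N .$$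
   Context: $\Omega=(0,L)^2$; $\langle\cdot,\cdot\rangle_2$, $\|\cdot\|_2$ are the $L^2(\Omega)$ inner product and norm; $\langle u,v\rangle_{H^1}=\langle u,v\rangle_2+\langle\nabla u,\nabla v\rangle_2$, with norm $\|\cdot\|_{H^1}$; $|v|_{1,4}=\left(\int_\Omega|\nabla v|^4\right)^{1/4}$. For a function $u$, $\vec V(u)=(-u_y,u_x)$. $p\in W^{1,\infty}(\Omega)$ is given, $\|p\|_{1,\infty}=\max\{\|p\|_{L^\infty},\|p_x\|_{L^\infty},\|p_y\|_{L^\infty}\}$ (with $1/0=+\infty$). $T>0$ is fixed. $w_0=u_0-\Delta u_0\in L^2(\Omega)$, where $u_0\in H^2(\Omega)\cap H^1_P$ is given and $H^1_P$ is the space of $H^1(\Omega)$ functions that are periodic. Finite elements: $\overline\Omega$ is covered by an $n\times n$ tensor grid of nodes and a conforming structured triangulation based on it, with mesh size $h$. $X_N$ is the space of continuous functions on $\overline\Omega$ that are affine on each triangle; $X_{N,P}\subset X_N$ is the subspace of functions satisfying periodic boundary conditions, of dimension $N=(n-1)^2$, with nodal basis $\varphi_1,\dots,\varphi_N$. $c_{0,inv}>0$ is a constant such that $\|v\|_{H^1}\le\frac{c_{0,inv}}{h}\|v\|_2$ for all $v\in X_N$. $N\times N$ matrices: $M_{I,J}=\langle\varphi_I,\varphi_J\rangle_2$, $K_{I,J}=\langle\varphi_I,\varphi_J\rangle_{H^1}$, $R_{I,J}=\langle\vec V(p)\cdot\nabla\varphi_J,\varphi_I\rangle_2$; for $U\in\mathbb{R}^N$,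 $S_{I,J}(U)=-\langle\vec V(\sum_LU_L\varphi_L)\cdot\nabla\varphi_I,\varphi_J\rangle_2$; for $W\in\mathbb{R}^N$, $B(W)=[\,S(e_1)W\ \ S(e_2)W\ \cdots\ S(e_N)W\,]$ with $e_j$ the canonical basis of $\mathbb{R}^N$. $\|a\|_M^2=a^TMa$. Fully implicit scheme: $W(0)$ is the coefficient vector of the $L^2$ projection of $w_0$ onto $X_{N,P}$, $KU(0)=MW(0)$, and for each discrete time $t=m\tau$ with $t+\tau\le T$, $(M+\tau S(U(t+\tau)))W(t+\tau)-\tau RU(t+\tau)=MW(t)$ and $KU(s)=MW(s)$ for $s\in\{t,t+\tau\}$. It is known (earlier work) that, given $(U(t),W(t))$, this system has a unique solution $(U(t+\tau),W(t+\tau))$ when $\tau\le\min\{\frac{1}{2\|p\|_{1,\infty}},\frac{h^2}{16c_{0,inv}\|W(t)\|_M}\}$. Put $\phi_N=\sum_IU_I(t+\tau)\varphi_I$, $\psi_N=\sum_IW_I(t+\tau)\varphi_I$. Newton's method: $(U^{(0)},W^{(0)})=(U(t),W(t))$ and, for $k\ge0$, $(U^{(k+1)},W^{(k+1)})$ solves $$\begin{bmatrix}\tau B(W^{(k)})-\tau R&M+\tau S(U^{(k)})\\ K&-M\end{bmatrix}\begin{bmatrix}U^{(k+1)}\\ W^{(k+1)}\end{bmatrix}=\begin{bmatrix}\tau S(U^{(k)})W^{(k)}+MW(t)\\ 0\end{bmatrix}.$$ $\phi_N^{(k)}=\sum_IU^{(k)}_I\varphi_I$ and $\psi_N^{(k)}=\sum_IW^{(k)}_I\varphi_I$.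 *)

theory Defs
  imports "HOL-Analysis.Analysis" "HOL-Probability.Essential_Supremum"
begin

text \<open>
  Functions are total functions on the plane; only their values on the domain matter, and elements
  of the Lebesgue and Sobolev spaces are represented by arbitrary members of their classes.
\<close>

definition L2_fun :: "'a::euclidean_space set \<Rightarrow> ('a \<Rightarrow> real) \<Rightarrow> bool" where
  "L2_fun S f \<longleftrightarrow> f \<in> borel_measurable (lebesgue_on S) \<and> integrable (lebesgue_on S) (\<lambda>z. (f z)\<^sup>2)"

definition L2_inner :: "'a::euclidean_space set \<Rightarrow> ('a \<Rightarrow> real) \<Rightarrow> ('a \<Rightarrow> real) \<Rightarrow> real" where
  "L2_inner S f g = (LINT z|lebesgue_on S. f z * g z)"

definition L2_norm :: "'a::euclidean_space set \<Rightarrow> ('a \<Rightarrow> real) \<Rightarrow> real" where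
  "L2_norm S f = sqrt (L2_inner S f f)"

definition Linf_norm :: "'a::euclidean_space set \<Rightarrow> ('a \<Rightarrow> real) \<Rightarrow> ereal" where
  "Linf_norm S f = esssup (lebesgue_on S) (\<lambda>z. ereal \<bar>f z\<bar>)"

definition Linf_fun :: "'a::euclidean_space set \<Rightarrow> ('a \<Rightarrow> real) \<Rightarrow> bool" where
  "Linf_fun S f \<longleftrightarrow> f \<in> borel_measurable (lebesgue_on S) \<and> Linf_norm S f < \<infinity>"

definition partial :: "real \<times> real \<Rightarrow> (real \<times> real \<Rightarrow> real) \<Rightarrow> real \<times> real \<Rightarrow> real" where
  "partial b f z = frechet_derivative f (at z) b"

text \<open>Infinitely differentiable on the plane: \<open>D i j\<close> is the partial derivative of \<open>f\<close> of
  order \<open>i\<close> in the first and \<open>j\<close> in the second variable.\<close>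

definition smooth :: "(real \<times> real \<Rightarrow> real) \<Rightarrow> bool" where
  "smooth f \<longleftrightarrow> (\<exists>D :: nat \<Rightarrow> nat \<Rightarrow> real \<times> real \<Rightarrow> real. D 0 0 = f \<and>
     (\<forall>i j z. (D i j has_derivative (\<lambda>v. fst v * D (Suc i) j z + snd v * D i (Suc j) z)) (at z)))"

definition test_fun :: "(real \<times> real) set \<Rightarrow> (real \<times> real \<Rightarrow> real) \<Rightarrow> bool" where
  "test_fun S \<eta> \<longleftrightarrow> smooth \<eta> \<and> compact (closure {z. \<eta> z \<noteq> 0}) \<and> closure {z. \<eta> z \<noteq> 0} \<subseteq> S"

definition locally_integrable :: "(real \<times> real) set \<Rightarrow> (real \<times> real \<Rightarrow> real) \<Rightarrow> bool" where
  "locally_integrable S f \<longleftrightarrow> (\<forall>C. compact C \<and> C \<subseteq> S \<longrightarrow> integrable (lebesgue_on C) f)"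

definition has_weak_partial ::
  "(real \<times> real) set \<Rightarrow> real \<times> real \<Rightarrow> (real \<times> real \<Rightarrow> real) \<Rightarrow> (real \<times> real \<Rightarrow> real) \<Rightarrow> bool" where
  "has_weak_partial S b f g \<longleftrightarrow> locally_integrable S f \<and> locally_integrable S g \<and>
     (\<forall>\<eta>. test_fun S \<eta> \<longrightarrow> L2_inner S f (partial b \<eta>) = - L2_inner S g \<eta>)"

text \<open>A chosen representative; weak derivatives are unique up to null sets. Here and below,
  \<open>b \<in> Basis\<close> means that \<open>b\<close> is one of the unit vectors \<open>(1, 0)\<close>, \<open>(0, 1)\<close>.\<close>

definition weak_partial ::
  "(real \<times> real) set \<Rightarrow> real \<times> real \<Rightarrow> (real \<times> real \<Rightarrow> real) \<Rightarrow> real \<times> real \<Rightarrow> real" where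
  "weak_partial S b f = (SOME g. has_weak_partial S b f g)"

definition weak_grad :: "(real \<times> real) set \<Rightarrow> (real \<times> real \<Rightarrow> real) \<Rightarrow> real \<times> real \<Rightarrow> real \<times> real" where
  "weak_grad S f z = (weak_partial S (1, 0) f z, weak_partial S (0, 1) f z)"

definition weak_laplacian :: "(real \<times> real) set \<Rightarrow> (real \<times> real \<Rightarrow> real) \<Rightarrow> real \<times> real \<Rightarrow> real" where
  "weak_laplacian S f z =
     weak_partial S (1, 0) (weak_partial S (1, 0) f) z + weak_partial S (0, 1) (weak_partial S (0, 1) f) z"

definition weakly_differentiable :: "(real \<times> real) set \<Rightarrow> (real \<times> real \<Rightarrow> real) \<Rightarrow> bool" where
  "weakly_differentiable S f \<longleftrightarrow> (\<forall>b\<in>Basis. has_weak_partial S b f (weak_partial S b f))"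

definition H1_fun :: "(real \<times> real) set \<Rightarrow> (real \<times> real \<Rightarrow> real) \<Rightarrow> bool" where
  "H1_fun S f \<longleftrightarrow> L2_fun S f \<and> weakly_differentiable S f \<and> (\<forall>b\<in>Basis. L2_fun S (weak_partial S b f))"

definition H2_fun :: "(real \<times> real) set \<Rightarrow> (real \<times> real \<Rightarrow> real) \<Rightarrow> bool" where
  "H2_fun S f \<longleftrightarrow> H1_fun S f \<and> (\<forall>b\<in>Basis. H1_fun S (weak_partial S b f))"

definition W1inf_fun :: "(real \<times> real) set \<Rightarrow> (real \<times> real \<Rightarrow> real) \<Rightarrow> bool" where
  "W1inf_fun S f \<longleftrightarrow> Linf_fun S f \<and> weakly_differentiable S f \<and> (\<forall>b\<in>Basis. Linf_fun S (weak_partial S b f))"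

definition W1inf_norm :: "(real \<times> real) set \<Rightarrow> (real \<times> real \<Rightarrow> real) \<Rightarrow> real" where
  "W1inf_norm S f = real_of_ereal (max (Linf_norm S f)
     (max (Linf_norm S (weak_partial S (1, 0) f)) (Linf_norm S (weak_partial S (0, 1) f))))"

definition square :: "real \<Rightarrow> (real \<times> real) set" where
  "square L = {0<..<L} \<times> {0<..<L}"

text \<open>\<open>g\<close> is the trace of \<open>u\<close> on the side of the square parametrised by \<open>\<gamma>\<close> on \<open>(0, L)\<close>. As usual,
  the trace operator is the extension by continuity of the restriction of functions
  that are smooth up to the boundary.\<close>

definition has_side_trace ::
  "real \<Rightarrow> (real \<times> real \<Rightarrow> real) \<Rightarrow> (real \<Rightarrow> real \<times> real) \<Rightarrow> (real \<Rightarrow> real) \<Rightarrow> bool" where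
  "has_side_trace L u \<gamma> g \<longleftrightarrow> L2_fun {0<..<L} g \<and>
     (\<exists>\<xi> :: nat \<Rightarrow> real \<times> real \<Rightarrow> real. (\<forall>i. smooth (\<xi> i)) \<and>
        (\<lambda>i. L2_norm (square L) (\<lambda>z. \<xi> i z - u z)) \<longlonglongrightarrow> 0 \<and>
        (\<forall>b\<in>Basis. (\<lambda>i. L2_norm (square L) (\<lambda>z. partial b (\<xi> i) z - weak_partial (square L) b u z)) \<longlonglongrightarrow> 0) \<and>
        (\<lambda>i. L2_norm {0<..<L} (\<lambda>s. \<xi> i (\<gamma> s) - g s)) \<longlonglongrightarrow> 0)"

definition H1_periodic :: "real \<Rightarrow> (real \<times> real \<Rightarrow> real) \<Rightarrow> bool" where
  "H1_periodic L u \<longleftrightarrow> H1_fun (square L) u \<and>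
     (\<exists>g. has_side_trace L u (\<lambda>s. (0, s)) g \<and> has_side_trace L u (\<lambda>s. (L, s)) g) \<and>
     (\<exists>g. has_side_trace L u (\<lambda>s. (s, 0)) g \<and> has_side_trace L u (\<lambda>s. (s, L)) g)"

text \<open>The coordinates of the \<open>n\<close> grid points in each direction are \<open>x 0, \<dots>, x (n - 1)\<close>;
  the spacing need not be uniform.\<close>

definition grid_points :: "real \<Rightarrow> nat \<Rightarrow> (nat \<Rightarrow> real) \<Rightarrow> bool" where
  "grid_points L n x \<longleftrightarrow> 2 \<le> n \<and> x 0 = 0 \<and> x (n - 1) = L \<and> (\<forall>i<n - 1. x i < x (Suc i))"

text \<open>Every grid rectangle is cut into two triangles along one of its diagonals, selected
  by \<open>d i j\<close>. The resulting triangulation is conforming for every pattern of diagonals, in particular when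
  all of them are parallel.\<close>

definition cell_triangles ::
  "(nat \<Rightarrow> real) \<Rightarrow> (nat \<Rightarrow> real) \<Rightarrow> (nat \<Rightarrow> nat \<Rightarrow> bool) \<Rightarrow> nat \<Rightarrow> nat \<Rightarrow> (real \<times> real) set set" where
  "cell_triangles x y d i j =
     (let sw = (x i, y j); se = (x (Suc i), y j); nw = (x i, y (Suc j)); ne = (x (Suc i), y (Suc j))
      in if d i j then {convex hull {sw, se, ne}, convex hull {sw, nw, ne}}
         else {convex hull {sw, se, nw}, convex hull {se, nw, ne}})"

definition structured_triangulation ::
  "nat \<Rightarrow> (nat \<Rightarrow> real) \<Rightarrow> (nat \<Rightarrow> real) \<Rightarrow> (nat \<Rightarrow> nat \<Rightarrow> bool) \<Rightarrow> (real \<times> real) set set" where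
  "structured_triangulation n x y d = (\<Union>i<n - 1. \<Union>j<n - 1. cell_triangles x y d i j)"

definition mesh_size :: "(real \<times> real) set set \<Rightarrow> real" where
  "mesh_size \<T> = Max (diameter ` \<T>)"

definition affine_fun_on :: "(real \<times> real) set \<Rightarrow> (real \<times> real \<Rightarrow> real) \<Rightarrow> bool" where
  "affine_fun_on A v \<longleftrightarrow> (\<exists>a b c. \<forall>z\<in>A. v z = a + b * fst z + c * snd z)"

definition fe_space :: "real \<Rightarrow> (real \<times> real) set set \<Rightarrow> (real \<times> real \<Rightarrow> real) set" where
  "fe_space L \<T> = {v. continuous_on (closure (square L)) v \<and> (\<forall>A\<in>\<T>. affine_fun_on A v)}"

definition fe_space_periodic :: "real \<Rightarrow> (real \<times> real) set set \<Rightarrow> (real \<times> real \<Rightarrow> real) set" where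
  "fe_space_periodic L \<T> = {v \<in> fe_space L \<T>. \<forall>s\<in>{0..L}. v (0, s) = v (L, s) \<and> v (s, 0) = v (s, L)}"

text \<open>Under periodicity, the nodes \<open>(x i, y j)\<close> with \<open>i, j < n - 1\<close> represent all the nodes;
  \<open>\<nu>\<close> enumerates them, so that the index type has \<open>(n - 1)\<^sup>2\<close> elements.\<close>

definition nodal_basis ::
  "real \<Rightarrow> (real \<times> real) set set \<Rightarrow> nat \<Rightarrow> (nat \<Rightarrow> real) \<Rightarrow> (nat \<Rightarrow> real) \<Rightarrow>
   ('n::finite \<Rightarrow> nat \<times> nat) \<Rightarrow> ('n \<Rightarrow> real \<times> real \<Rightarrow> real) \<Rightarrow> bool" where
  "nodal_basis L \<T> n x y \<nu> \<phi> \<longleftrightarrow> bij_betw \<nu> UNIV ({..<n - 1} \<times> {..<n - 1}) \<and>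
     (\<forall>I. \<phi> I \<in> fe_space_periodic L \<T>) \<and>
     (\<forall>I J. \<phi> I (x (fst (\<nu> J)), y (snd (\<nu> J))) = (if I = J then 1 else 0))"

definition fe_fun :: "('n::finite \<Rightarrow> real \<times> real \<Rightarrow> real) \<Rightarrow> real^'n \<Rightarrow> real \<times> real \<Rightarrow> real" where
  "fe_fun \<phi> U z = (\<Sum>I\<in>UNIV. U $ I * \<phi> I z)"

text \<open>Finite element functions are differentiated classically in the interior of each triangle. This is
  their weak gradient; the union of the edges is a null set.\<close>

definition grad :: "(real \<times> real \<Rightarrow> real) \<Rightarrow> real \<times> real \<Rightarrow> real \<times> real" where
  "grad v z = (partial (1, 0) v z, partial (0, 1) v z)"

definition H1_inner :: "(real \<times> real) set \<Rightarrow> (real \<times> real \<Rightarrow> real) \<Rightarrow> (real \<times> real \<Rightarrow> real) \<Rightarrow> real" where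
  "H1_inner S u v = L2_inner S u v + (LINT z|lebesgue_on S. grad u z \<bullet> grad v z)"

definition H1_norm :: "(real \<times> real) set \<Rightarrow> (real \<times> real \<Rightarrow> real) \<Rightarrow> real" where
  "H1_norm S v = sqrt (H1_inner S v v)"

definition W14_seminorm :: "(real \<times> real) set \<Rightarrow> (real \<times> real \<Rightarrow> real) \<Rightarrow> real" where
  "W14_seminorm S v = (LINT z|lebesgue_on S. norm (grad v z) ^ 4) powr (1 / 4)"

definition is_L2_projection ::
  "real \<Rightarrow> (real \<times> real) set set \<Rightarrow> (real \<times> real \<Rightarrow> real) \<Rightarrow> (real \<times> real \<Rightarrow> real) \<Rightarrow> bool" where
  "is_L2_projection L \<T> f v \<longleftrightarrow> v \<in> fe_space_periodic L \<T> \<and>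
     (\<forall>\<psi>\<in>fe_space_periodic L \<T>. L2_inner (square L) (\<lambda>z. v z - f z) \<psi> = 0)"

text \<open>The vector field \<open>V(u) = (- u\<^sub>y, u\<^sub>x)\<close> is \<open>rot\<close> applied to the gradient of \<open>u\<close>.\<close>

definition rot :: "real \<times> real \<Rightarrow> real \<times> real" where
  "rot g = (- snd g, fst g)"

definition mass_matrix :: "real \<Rightarrow> ('n::finite \<Rightarrow> real \<times> real \<Rightarrow> real) \<Rightarrow> real^'n^'n" where
  "mass_matrix L \<phi> = (\<chi> I J. L2_inner (square L) (\<phi> I) (\<phi> J))"

definition K_matrix :: "real \<Rightarrow> ('n::finite \<Rightarrow> real \<times> real \<Rightarrow> real) \<Rightarrow> real^'n^'n" where
  "K_matrix L \<phi> = (\<chi> I J. H1_inner (square L) (\<phi> I) (\<phi> J))"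

definition R_matrix ::
  "real \<Rightarrow> ('n::finite \<Rightarrow> real \<times> real \<Rightarrow> real) \<Rightarrow> (real \<times> real \<Rightarrow> real) \<Rightarrow> real^'n^'n" where
  "R_matrix L \<phi> p = (\<chi> I J.
     L2_inner (square L) (\<lambda>z. rot (weak_grad (square L) p z) \<bullet> grad (\<phi> J) z) (\<phi> I))"

definition S_matrix :: "real \<Rightarrow> ('n::finite \<Rightarrow> real \<times> real \<Rightarrow> real) \<Rightarrow> real^'n \<Rightarrow> real^'n^'n" where
  "S_matrix L \<phi> U = (\<chi> I J.
     - L2_inner (square L) (\<lambda>z. rot (grad (fe_fun \<phi> U) z) \<bullet> grad (\<phi> I) z) (\<phi> J))"

text \<open>The column of \<open>B(W)\<close> with index \<open>J\<close> is \<open>S(e\<^sub>J) W\<close>.\<close>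

definition B_matrix :: "real \<Rightarrow> ('n::finite \<Rightarrow> real \<times> real \<Rightarrow> real) \<Rightarrow> real^'n \<Rightarrow> real^'n^'n" where
  "B_matrix L \<phi> W = (\<chi> I J. (S_matrix L \<phi> (axis J 1) *v W) $ I)"

definition M_norm :: "real \<Rightarrow> ('n::finite \<Rightarrow> real \<times> real \<Rightarrow> real) \<Rightarrow> real^'n \<Rightarrow> real" where
  "M_norm L \<phi> a = sqrt (a \<bullet> (mass_matrix L \<phi> *v a))"

definition implicit_step ::
  "real \<Rightarrow> ('n::finite \<Rightarrow> real \<times> real \<Rightarrow> real) \<Rightarrow> (real \<times> real \<Rightarrow> real) \<Rightarrow> real \<Rightarrow>
   real^'n \<Rightarrow> real^'n \<Rightarrow> real^'n \<Rightarrow> real^'n \<Rightarrow> bool" where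
  "implicit_step L \<phi> p \<tau> U W U' W' \<longleftrightarrow>
     (mass_matrix L \<phi> + \<tau> *\<^sub>R S_matrix L \<phi> U') *v W' - \<tau> *\<^sub>R (R_matrix L \<phi> p *v U') = mass_matrix L \<phi> *v W \<and>
     K_matrix L \<phi> *v U = mass_matrix L \<phi> *v W \<and>
     K_matrix L \<phi> *v U' = mass_matrix L \<phi> *v W'"

text \<open>\<open>U i\<close> and \<open>W i\<close> stand for the values at time \<open>i * \<tau>\<close>, for \<open>i \<le> m\<close>.\<close>

definition implicit_scheme ::
  "real \<Rightarrow> (real \<times> real) set set \<Rightarrow> ('n::finite \<Rightarrow> real \<times> real \<Rightarrow> real) \<Rightarrow> (real \<times> real \<Rightarrow> real) \<Rightarrow>
   (real \<times> real \<Rightarrow> real) \<Rightarrow> real \<Rightarrow> nat \<Rightarrow> (nat \<Rightarrow> real^'n) \<Rightarrow> (nat \<Rightarrow> real^'n) \<Rightarrow> bool" where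
  "implicit_scheme L \<T> \<phi> p w0 \<tau> m U W \<longleftrightarrow>
     is_L2_projection L \<T> w0 (fe_fun \<phi> (W 0)) \<and>
     K_matrix L \<phi> *v U 0 = mass_matrix L \<phi> *v W 0 \<and>
     (\<forall>i<m. implicit_step L \<phi> p \<tau> (U i) (W i) (U (Suc i)) (W (Suc i)))"

text \<open>The two block rows of the linear system for \<open>(U', W')\<close>, where \<open>(U, W)\<close> is the
  current iterate and \<open>Wt\<close> the value at the old time.\<close>

definition newton_step ::
  "real \<Rightarrow> ('n::finite \<Rightarrow> real \<times> real \<Rightarrow> real) \<Rightarrow> (real \<times> real \<Rightarrow> real) \<Rightarrow> real \<Rightarrow>
   real^'n \<Rightarrow> real^'n \<Rightarrow> real^'n \<Rightarrow> real^'n \<Rightarrow> real^'n \<Rightarrow> bool" where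
  "newton_step L \<phi> p \<tau> Wt U W U' W' \<longleftrightarrow>
     (\<tau> *\<^sub>R B_matrix L \<phi> W - \<tau> *\<^sub>R R_matrix L \<phi> p) *v U' + (mass_matrix L \<phi> + \<tau> *\<^sub>R S_matrix L \<phi> U) *v W'
       = \<tau> *\<^sub>R (S_matrix L \<phi> U *v W) + mass_matrix L \<phi> *v Wt \<and>
     K_matrix L \<phi> *v U' - mass_matrix L \<phi> *v W' = 0"

definition newton_iterates ::
  "real \<Rightarrow> ('n::finite \<Rightarrow> real \<times> real \<Rightarrow> real) \<Rightarrow> (real \<times> real \<Rightarrow> real) \<Rightarrow> real \<Rightarrow>
   real^'n \<Rightarrow> real^'n \<Rightarrow> (nat \<Rightarrow> real^'n) \<Rightarrow> (nat \<Rightarrow> real^'n) \<Rightarrow> bool" where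
  "newton_iterates L \<phi> p \<tau> Ut Wt NU NW \<longleftrightarrow> NU 0 = Ut \<and> NW 0 = Wt \<and>
     (\<forall>k. newton_step L \<phi> p \<tau> Wt (NU k) (NW k) (NU (Suc k)) (NW (Suc k)))"

end

theory Submission
  imports Defs
begin

text \<open>
  The matrix \<open>S(U)\<close> represents the trilinear form
  \<open>b(u, v, w) = \<integral> (V(u) \<bullet> \<nabla>v) w\<close>, and \<open>b(u, v, v) = 0\<close> for periodic finite
  element functions: on each triangle the integral is a sum of terms attached to the oriented edges, and these
  cancel in pairs over the triangulation. Testing the scheme with \<open>W(t + \<tau>)\<close> therefore gives
  \<open>(1 - 2 \<tau> \<parallel>p\<parallel>) \<parallel>\<psi>(t + \<tau>)\<parallel> \<le> \<parallel>\<psi>(t)\<parallel>\<close>, whence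
  \<open>\<parallel>\<psi>(t)\<parallel> \<le> exp (3 T \<parallel>p\<parallel>) \<parallel>w\<^sub>0\<parallel>\<close>; the same test and Brouwer's theorem give a
  solution of the implicit step. For the Newton errors \<open>a\<^sub>k = U\<^sub>k - U(t + \<tau>)\<close> and
  \<open>b\<^sub>k = W\<^sub>k - W(t + \<tau>)\<close>, bilinearity yields
  \<open>M b\<^sub>k\<^sub>+\<^sub>1 - \<tau> R a\<^sub>k\<^sub>+\<^sub>1 + \<tau> (S(a\<^sub>k\<^sub>+\<^sub>1) W(t + \<tau>) + S(U\<^sub>k) b\<^sub>k\<^sub>+\<^sub>1 + S(U\<^sub>k\<^sub>+\<^sub>1 - U\<^sub>k) b\<^sub>k) = 0\<close>.
  Tested with \<open>b\<^sub>k\<^sub>+\<^sub>1\<close>, the term with \<open>S(U\<^sub>k)\<close> vanishes, and the last one is small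
  because consecutive iterates are within \<open>\<epsilon>\<close>; the bound on \<open>\<tau>\<close> leaves
  \<open>\<parallel>b\<^sub>k\<^sub>+\<^sub>1\<parallel> \<le> \<parallel>b\<^sub>k\<parallel> / 2\<close>.
\<close>

section \<open>Newton's method for the algebraic system\<close>

text \<open>A quadratic in \<open>t\<close> without negative values has nonpositive discriminant.
  Both Cauchy-Schwarz inequalities below, for the mass matrix and for L2, reduce to this.\<close>

lemma discriminant_bound:
  fixes a b c :: real
  assumes nonneg: "\<And>t. 0 \<le> a + 2 * t * b + t\<^sup>2 * c"
  shows "\<bar>b\<bar> \<le> sqrt a * sqrt c"
proof -
  have a: "0 \<le> a" using nonneg[of 0] by simp
  have "b\<^sup>2 \<le> a * c"
  proof (cases "c = 0")
    case True
    have "b = 0"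
    proof (rule ccontr)
      assume "b \<noteq> 0"
      \<comment> \<open>With \<open>c = 0\<close> this choice of \<open>t\<close> gives the value
        -1.\<close>
      then show False
        using nonneg[of "- (a + 1) / (2 * b)"] True by (simp add: field_simps)
    qed
    with True show ?thesis by simp
  next
    case False
    have "c > 0"
    proof (rule ccontr)
      assume "\<not> c > 0"
      with False have c: "c < 0" by simp
      \<comment> \<open>Adding the values at \<open>t\<close> and \<open>-t\<close> removes the
        linear term, after which a large \<open>t\<close> contradicts \<open>c < 0\<close>.\<close>
      have "0 \<le> (a + 2 * t * b + t\<^sup>2 * c) + (a + 2 * (-t) * b + (-t)\<^sup>2 * c)" for t
        using nonneg[of t] nonneg[of "-t"] by linarith
      then have *: "0 \<le> a + t\<^sup>2 * c" for t by (smt (verit) mult_minus_left mult_minus_right power2_minus)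
      show False using *[of "sqrt ((a + 1) / (-c))"] a c by (simp add: field_simps)
    qed
    \<comment> \<open>The parabola is evaluated at its minimum \<open>- b / c\<close>.\<close>
    then show ?thesis
      using nonneg[of "- b / c"] by (simp add: field_simps power2_eq_square)
  qed
  then have "\<bar>b\<bar> \<le> sqrt (a * c)" by (simp add: real_le_rsqrt)
  then show ?thesis by (simp add: real_sqrt_mult)
qed

text \<open>The product \<open>(1 - 2 * s) * (1 + 3 * s)\<close> equals
  \<open>1 + s * (1 - 6 * s)\<close>. With \<open>s = \<tau> * P\<close> this turns the one-step
  growth factor \<open>1 / (1 - 2 * s)\<close> into an exponential and ties the 6 in the step
  restriction to the 3 in the exponent.\<close>

lemma one_le_mult_exp:
  fixes s :: real
  assumes "0 \<le> s" "6 * s \<le> 1"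
  shows "1 \<le> (1 - 2 * s) * exp (3 * s)"
proof -
  have "0 \<le> s * (1 - 6 * s)" using assms by simp
  then have "1 \<le> (1 - 2 * s) * (1 + 3 * s)" by (simp add: algebra_simps)
  also have "\<dots> \<le> (1 - 2 * s) * exp (3 * s)"
    using assms by (intro mult_left_mono exp_ge_add_one_self) auto
  finally show ?thesis .
qed

text \<open>The Newton argument sees the matrices only through these properties. \<open>P\<close> is
  to be the norm of \<open>p\<close>, and \<open>C\<close> the square of the constant in the inverse
  estimate. \<open>R\<close> differentiates its argument, so its bound carries the energy norm given
  by \<open>K\<close>, while \<open>S_bound\<close> involves the L2 norm alone.\<close>

locale discrete_scheme =
  fixes L :: real and \<phi> :: "'n::finite \<Rightarrow> real \<times> real \<Rightarrow> real" and p :: "real \<times> real \<Rightarrow> real"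
    and P C :: real
  assumes M_sym: "a \<bullet> (mass_matrix L \<phi> *v b) = b \<bullet> (mass_matrix L \<phi> *v a)"
    and M_pos: "a \<noteq> 0 \<Longrightarrow> 0 < a \<bullet> (mass_matrix L \<phi> *v a)"
    and M_le_K: "a \<bullet> (mass_matrix L \<phi> *v a) \<le> a \<bullet> (K_matrix L \<phi> *v a)"
    and S_linear: "linear (S_matrix L \<phi>)"
    and S_skew: "b \<bullet> (S_matrix L \<phi> a *v b) = 0"
    and S_bound: "\<bar>c \<bullet> (S_matrix L \<phi> a *v b)\<bar> \<le> C * M_norm L \<phi> a * M_norm L \<phi> b * M_norm L \<phi> c"
    and R_bound: "\<bar>b \<bullet> (R_matrix L \<phi> p *v a)\<bar> \<le> 2 * P * sqrt (a \<bullet> (K_matrix L \<phi> *v a)) * M_norm L \<phi> b"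
    and C_nonneg: "0 \<le> C" and P_nonneg: "0 \<le> P"
begin

abbreviation "M \<equiv> mass_matrix L \<phi>"
abbreviation "K \<equiv> K_matrix L \<phi>"
abbreviation "S \<equiv> S_matrix L \<phi>"
abbreviation "R \<equiv> R_matrix L \<phi> p"
abbreviation "N \<equiv> M_norm L \<phi>"

section \<open>The mass-matrix norm and the discrete elliptic equation\<close>

lemma M_nonneg: "0 \<le> a \<bullet> (M *v a)"
  using M_pos[of a] by (cases "a = 0") auto

lemma N_nonneg: "0 \<le> N a"
  by (simp add: M_norm_def M_nonneg)

lemma N_sq: "(N a)\<^sup>2 = a \<bullet> (M *v a)"
  by (simp add: M_norm_def M_nonneg)

lemma N_eq_0_iff: "N a = 0 \<longleftrightarrow> a = 0"
  using M_pos[of a] by (cases "a = 0") (auto simp: M_norm_def)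

lemma M_Cauchy_Schwarz: "\<bar>a \<bullet> (M *v b)\<bar> \<le> N a * N b"
proof -
  have "0 \<le> a \<bullet> (M *v a) + 2 * t * (a \<bullet> (M *v b)) + t\<^sup>2 * (b \<bullet> (M *v b))" for t
  proof -
    have "a \<bullet> (M *v a) + 2 * t * (a \<bullet> (M *v b)) + t\<^sup>2 * (b \<bullet> (M *v b))
        = (a + t *\<^sub>R b) \<bullet> (M *v (a + t *\<^sub>R b))"
      using M_sym[of a b]
      by (simp add: matrix_vector_right_distrib matrix_vector_mult_scaleR inner_add_left
        inner_add_right power2_eq_square algebra_simps)
    then show ?thesis by (simp add: M_nonneg)
  qed
  then show ?thesis unfolding M_norm_def by (rule discriminant_bound)
qed

text \<open>Testing the equation with \<open>a\<close> gives the squared energy norm on the left and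
  at most \<open>N a * N b\<close> on the right, and \<open>N a\<close> is below the energy norm.
  Division leaves the constant 1: the elliptic solve does not expand from L2 to H1.\<close>

lemma K_norm_le:
  assumes "K *v a = M *v b"
  shows "sqrt (a \<bullet> (K *v a)) \<le> N b"
proof -
  let ?k = "sqrt (a \<bullet> (K *v a))"
  have K0: "0 \<le> a \<bullet> (K *v a)" using M_le_K[of a] M_nonneg[of a] by linarith
  have "?k * ?k = a \<bullet> (M *v b)" using K0 assms by simp
  also have "\<dots> \<le> N a * N b" using M_Cauchy_Schwarz[of a b] by linarith
  also have "\<dots> \<le> ?k * N b"
    using M_le_K[of a] by (intro mult_right_mono) (auto simp: M_norm_def M_nonneg)
  finally show ?thesis
    using K0 N_nonneg[of b] by (cases "?k = 0") (simp_all del: real_sqrt_mult_self add: mult_le_cancel_left)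
qed

lemma N_le:
  assumes "K *v a = M *v b"
  shows "N a \<le> N b"
proof -
  have "N a \<le> sqrt (a \<bullet> (K *v a))" unfolding M_norm_def using M_le_K[of a] by simp
  with K_norm_le[OF assms] show ?thesis by linarith
qed

lemma R_bound':
  assumes "K *v a = M *v b"
  shows "\<bar>c \<bullet> (R *v a)\<bar> \<le> 2 * P * N b * N c"
proof -
  have "\<bar>c \<bullet> (R *v a)\<bar> \<le> 2 * P * sqrt (a \<bullet> (K *v a)) * N c" by (rule R_bound)
  also have "\<dots> \<le> 2 * P * N b * N c"
    using K_norm_le[OF assms] by (intro mult_right_mono mult_left_mono) (auto simp: P_nonneg N_nonneg)
  finally show ?thesis .
qed

lemma K_inj: "K *v a = 0 \<Longrightarrow> a = 0"
  using M_le_K[of a] M_pos[of a] by (cases "a = 0") auto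

lemma S_diff: "S (a - b) *v c = S a *v c - S b *v c"
  using linear_diff[OF S_linear] by (simp add: matrix_vector_mult_diff_rdistrib)

text \<open>Expand \<open>a\<close> in the canonical basis and use linearity of \<open>S\<close>.
  The block \<open>B\<close> of the Newton matrix thus supplies the derivative of
  \<open>S U *v W\<close> with respect to \<open>U\<close>.\<close>

lemma B_matrix_mult: "B_matrix L \<phi> b *v a = S a *v b"
proof -
  have "S a = S (\<Sum>J\<in>UNIV. a $ J *\<^sub>R axis J 1)"
    by (rule arg_cong[where f = S]) (simp add: vec_eq_iff axis_def if_distrib[of "\<lambda>u. _ * u"] cong: if_cong)
  also have "\<dots> = (\<Sum>J\<in>UNIV. a $ J *\<^sub>R S (axis J 1))"
    by (simp add: linear_sum[OF S_linear] linear_scale[OF S_linear])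
  finally have *: "S a = (\<Sum>J\<in>UNIV. a $ J *\<^sub>R S (axis J 1))" .
  have "(S a *v b) $ I = (\<Sum>J\<in>UNIV. a $ J * (S (axis J 1) *v b) $ I)" for I
  proof -
    have "(S a *v b) $ I = (\<Sum>k\<in>UNIV. \<Sum>J\<in>UNIV. a $ J * S (axis J 1) $ I $ k * b $ k)"
      by (subst *) (simp add: matrix_vector_mult_def sum_distrib_right)
    also have "\<dots> = (\<Sum>J\<in>UNIV. \<Sum>k\<in>UNIV. a $ J * S (axis J 1) $ I $ k * b $ k)"
      by (rule sum.swap)
    finally show ?thesis
      by (simp add: matrix_vector_mult_def sum_distrib_left mult.assoc)
  qed
  then show ?thesis
    by (simp add: vec_eq_iff) (simp add: matrix_vector_mult_def B_matrix_def mult.commute)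
qed

lemma implicit_step_iff:
  "implicit_step L \<phi> p \<tau> U W U' W' \<longleftrightarrow>
     M *v W' + \<tau> *\<^sub>R (S U' *v W') - \<tau> *\<^sub>R (R *v U') = M *v W \<and>
     K *v U = M *v W \<and> K *v U' = M *v W'"
  by (simp add: implicit_step_def matrix_vector_mult_add_rdistrib scaleR_matrix_vector_assoc)

lemma newton_step_iff:
  "newton_step L \<phi> p \<tau> Wt U W U' W' \<longleftrightarrow>
     \<tau> *\<^sub>R (S U' *v W) - \<tau> *\<^sub>R (R *v U') + M *v W' + \<tau> *\<^sub>R (S U *v W')
       = \<tau> *\<^sub>R (S U *v W) + M *v Wt \<and> K *v U' = M *v W'"
  by (simp add: newton_step_def matrix_vector_mult_add_rdistrib matrix_vector_mult_diff_rdistrib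
      scaleR_matrix_vector_assoc[symmetric] B_matrix_mult add.assoc)

section \<open>Stability of the implicit scheme\<close>

lemma implicit_step_stable:
  assumes "implicit_step L \<phi> p \<tau> U W U' W'" and "0 < \<tau>"
  shows "(1 - 2 * (\<tau> * P)) * N W' \<le> N W"
proof -
  have eq: "M *v W' + \<tau> *\<^sub>R (S U' *v W') - \<tau> *\<^sub>R (R *v U') = M *v W" and K: "K *v U' = M *v W'"
    using assms(1) by (auto simp: implicit_step_iff)
  have "(N W')\<^sup>2 - \<tau> * (W' \<bullet> (R *v U')) = W' \<bullet> (M *v W)"
    using arg_cong[OF eq, of "\<lambda>v. W' \<bullet> v"]
    by (simp add: inner_add_right inner_diff_right S_skew N_sq)
  moreover have "W' \<bullet> (M *v W) \<le> N W' * N W" using M_Cauchy_Schwarz[of W' W] by linarith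
  moreover have "\<tau> * (W' \<bullet> (R *v U')) \<le> \<tau> * (2 * P * N W' * N W')"
    using R_bound'[OF K, of W'] assms(2) by (intro mult_left_mono) auto
  ultimately have "N W' * ((1 - 2 * (\<tau> * P)) * N W') \<le> N W' * N W"
    by (simp add: power2_eq_square algebra_simps)
  then show ?thesis
    using N_nonneg[of W'] N_nonneg[of W] by (cases "N W' = 0") (auto simp: mult_le_cancel_left)
qed

lemma implicit_step_exp:
  assumes "implicit_step L \<phi> p \<tau> U W U' W'" and "0 < \<tau>" and "6 * (\<tau> * P) \<le> 1"
  shows "N W' \<le> exp (3 * (\<tau> * P)) * N W"
proof -
  have "N W' \<le> ((1 - 2 * (\<tau> * P)) * exp (3 * (\<tau> * P))) * N W'"
    using one_le_mult_exp[of "\<tau> * P"] assms P_nonneg N_nonneg[of W'] by (simp add: mult_le_cancel_right1)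
  also have "\<dots> = exp (3 * (\<tau> * P)) * ((1 - 2 * (\<tau> * P)) * N W')" by simp
  also have "\<dots> \<le> exp (3 * (\<tau> * P)) * N W"
    using implicit_step_stable[OF assms(1,2)] by (intro mult_left_mono) auto
  finally show ?thesis .
qed

lemma implicit_scheme_bound:
  assumes "\<And>i. i < m \<Longrightarrow> implicit_step L \<phi> p \<tau> (U i) (W i) (U (Suc i)) (W (Suc i))"
    and "0 < \<tau>" and "6 * (\<tau> * P) \<le> 1"
  shows "N (W m) \<le> exp (3 * (real m * \<tau> * P)) * N (W 0)"
  using assms(1)
proof (induction m)
  case 0
  show ?case by simp
next
  case (Suc m)
  have "N (W (Suc m)) \<le> exp (3 * (\<tau> * P)) * N (W m)"
    using Suc.prems assms(2,3) by (intro implicit_step_exp) auto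
  also have "\<dots> \<le> exp (3 * (\<tau> * P)) * (exp (3 * (real m * \<tau> * P)) * N (W 0))"
    using Suc by (intro mult_left_mono) auto
  also have "\<dots> = exp (3 * (real (Suc m) * \<tau> * P)) * N (W 0)"
    by (simp add: algebra_simps flip: exp_add)
  finally show ?case .
qed

section \<open>Unique solvability of the implicit step\<close>

lemma implicit_step_unique:
  assumes "implicit_step L \<phi> p \<tau> U W U1 W1" and "implicit_step L \<phi> p \<tau> U W U2 W2"
    and "0 < \<tau>" and small: "\<tau> * (2 * P + C * N W1) < 1"
  shows "U2 = U1 \<and> W2 = W1"
proof -
  define a b where "a = U2 - U1" and "b = W2 - W1"
  have K: "K *v a = M *v b"
    using assms(1,2) by (simp add: implicit_step_iff a_def b_def matrix_vector_mult_diff_distrib)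
  have eq1: "M *v W1 + \<tau> *\<^sub>R (S U1 *v W1) - \<tau> *\<^sub>R (R *v U1) = M *v W"
    and eq2: "M *v W2 + \<tau> *\<^sub>R (S U2 *v W2) - \<tau> *\<^sub>R (R *v U2) = M *v W"
    using assms(1,2) by (auto simp: implicit_step_iff)
  \<comment> \<open>The bilinear terms are split asymmetrically: \<open>S U2 *v b\<close> disappears
    when tested with \<open>b\<close>, so that only the size of \<open>W1\<close> enters.\<close>
  have split: "S U2 *v W2 - S U1 *v W1 = S a *v W1 + S U2 *v b"
    by (simp add: a_def b_def S_diff matrix_vector_mult_diff_distrib)
  have "M *v b + \<tau> *\<^sub>R (S a *v W1 + S U2 *v b) - \<tau> *\<^sub>R (R *v a)
      = (M *v W2 + \<tau> *\<^sub>R (S U2 *v W2) - \<tau> *\<^sub>R (R *v U2)) - (M *v W1 + \<tau> *\<^sub>R (S U1 *v W1) - \<tau> *\<^sub>R (R *v U1))"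
    unfolding split[symmetric] by (simp add: a_def b_def matrix_vector_mult_diff_distrib scaleR_diff_right)
  then have "M *v b + \<tau> *\<^sub>R (S a *v W1 + S U2 *v b) - \<tau> *\<^sub>R (R *v a) = 0"
    using eq1 eq2 by simp
  from arg_cong[OF this, of "\<lambda>v. b \<bullet> v"]
  have "(N b)\<^sup>2 + \<tau> * (b \<bullet> (S a *v W1)) - \<tau> * (b \<bullet> (R *v a)) = 0"
    by (simp add: inner_add_right inner_diff_right S_skew N_sq)
  moreover have "\<tau> * (b \<bullet> (R *v a)) \<le> \<tau> * (2 * P * N b * N b)"
    using R_bound'[OF K, of b] assms(3) by (intro mult_left_mono) auto
  moreover have "\<tau> * - (b \<bullet> (S a *v W1)) \<le> \<tau> * (C * N b * N W1 * N b)"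
  proof (intro mult_left_mono)
    have "- (b \<bullet> (S a *v W1)) \<le> C * N a * N W1 * N b" using S_bound[of b a W1] by linarith
    also have "\<dots> \<le> C * N b * N W1 * N b"
      using N_le[OF K] by (intro mult_right_mono mult_left_mono) (auto simp: C_nonneg N_nonneg)
    finally show "- (b \<bullet> (S a *v W1)) \<le> C * N b * N W1 * N b" .
  qed (use assms(3) in simp)
  ultimately have "(1 - \<tau> * (2 * P + C * N W1)) * (N b)\<^sup>2 \<le> 0"
    by (simp add: power2_eq_square algebra_simps)
  then have "b = 0" using small by (simp add: mult_le_0_iff N_eq_0_iff)
  moreover have "a = 0" using K \<open>b = 0\<close> K_inj[of a] by simp
  ultimately show ?thesis by (simp add: a_def b_def)
qed

lemma implicit_step_exists:
  assumes K0: "K *v U = M *v W" and "0 < \<tau>" and small: "2 * (\<tau> * P) < 1"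
  shows "\<exists>U' W'. implicit_step L \<phi> p \<tau> U W U' W'"
proof -
  have "inj ((*v) K)"
    using K_inj by (auto simp: linear_injective_0)
  then obtain Ki where Ki: "K ** Ki = mat 1"
    using matrix_left_invertible_injective[of K] matrix_left_right_inverse[of _ K] by auto
  \<comment> \<open>\<open>U'\<close> is eliminated: \<open>G x\<close> solves the elliptic equation
    with data \<open>x\<close>, and a zero of the residual \<open>F\<close> below is an implicit
    step.\<close>
  define G where "G x = Ki *v (M *v x)" for x
  have KG: "K *v G x = M *v x" for x
    by (simp add: G_def matrix_vector_mul_assoc matrix_mul_assoc Ki)
  define F where "F x = M *v x + \<tau> *\<^sub>R (S (G x) *v x) - \<tau> *\<^sub>R (R *v G x) - M *v W" for x
  \<comment> \<open>Equivalence of norms: Brouwer's theorem is applied on a Euclidean ball, while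
    the estimates are in \<open>N\<close>. The constant is the minimum of \<open>N\<close> on the
    unit sphere.\<close>
  obtain \<mu> where \<mu>: "\<mu> > 0" "\<And>x. \<mu> * norm x \<le> N x"
  proof -
    have "continuous_on (sphere 0 1) N"
      unfolding M_norm_def
      by (intro continuous_on_real_sqrt continuous_on_inner continuous_on_id matrix_vector_mult_linear_continuous_on)
    moreover have "sphere (0::real^'n) 1 \<noteq> {}" by simp
    ultimately obtain x0 where x0: "x0 \<in> sphere 0 1" "\<And>x. x \<in> sphere 0 1 \<Longrightarrow> N x0 \<le> N x"
      using continuous_attains_inf[of "sphere (0::real^'n) 1" N] compact_sphere by blast
    have "N x0 * norm x \<le> N x" for x
    proof (cases "x = 0")
      case False
      have "x = norm x *\<^sub>R ((1 / norm x) *\<^sub>R x)" using False by simp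
      moreover have "N (c *\<^sub>R y) = \<bar>c\<bar> * N y" for c y
      proof -
        have "(c *\<^sub>R y) \<bullet> (M *v (c *\<^sub>R y)) = c\<^sup>2 * (y \<bullet> (M *v y))"
          by (simp add: matrix_vector_mult_scaleR power2_eq_square)
        then show ?thesis by (simp add: M_norm_def real_sqrt_mult)
      qed
      ultimately have "N x = norm x * N ((1 / norm x) *\<^sub>R x)" by (metis abs_norm_cancel)
      moreover have "N x0 \<le> N ((1 / norm x) *\<^sub>R x)" using False by (intro x0(2)) simp
      ultimately show ?thesis by (simp add: mult.commute mult_left_mono)
    qed (simp add: N_nonneg)
    moreover have "N x0 > 0" using x0(1) N_eq_0_iff[of x0] N_nonneg[of x0] by fastforce
    ultimately show ?thesis using that by blast
  qed
  \<comment> \<open>On the sphere of radius \<open>\<rho>\<close>, \<open>N x\<close> exceeds the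
    stability bound \<open>N W / (1 - 2 * (\<tau> * P))\<close> that every solution obeys; the
    summand 1 makes this strict.\<close>
  define \<rho> where "\<rho> = (N W / (1 - 2 * (\<tau> * P)) + 1) / \<mu>"
  have \<rho>: "\<rho> > 0" unfolding \<rho>_def using \<mu> small N_nonneg[of W]
    by (intro divide_pos_pos add_nonneg_pos divide_nonneg_pos) auto
  have pos: "F x \<bullet> x > 0" if "norm x = \<rho>" for x
  proof -
    have "N W / (1 - 2 * (\<tau> * P)) + 1 \<le> N x"
      using \<mu>(2)[of x] \<mu>(1) that by (simp add: \<rho>_def)
    then have 1: "N W / (1 - 2 * (\<tau> * P)) < N x" by simp
    then have big: "N W < (1 - 2 * (\<tau> * P)) * N x" using small by (simp add: field_simps)
    have "N x > 0" using 1 N_nonneg[of W] small by (smt (verit) divide_nonneg_pos)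
    have "F x \<bullet> x = (N x)\<^sup>2 - \<tau> * (x \<bullet> (R *v G x)) - x \<bullet> (M *v W)"
      by (simp add: F_def inner_commute[of _ x] inner_add_right inner_diff_right S_skew N_sq)
    moreover have "\<tau> * (x \<bullet> (R *v G x)) \<le> \<tau> * (2 * P * N x * N x)"
      using R_bound'[OF KG, of x x] assms(2) by (intro mult_left_mono) auto
    moreover have "x \<bullet> (M *v W) \<le> N x * N W" using M_Cauchy_Schwarz[of x W] by linarith
    moreover have "N x * N W < N x * ((1 - 2 * (\<tau> * P)) * N x)" using big \<open>N x > 0\<close> by simp
    ultimately show ?thesis by (simp add: power2_eq_square algebra_simps)
  qed
  have contG: "continuous_on A G" for A
    unfolding G_def matrix_vector_mul_assoc by (rule matrix_vector_mult_linear_continuous_on)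
  have contF: "continuous_on A F" for A
  proof -
    have "continuous_on A (\<lambda>x. S (G x) *v x)"
    proof -
      have "continuous_on A (\<lambda>x. S (G x))"
        by (rule linear_continuous_on_compose[OF contG S_linear])
      then show ?thesis
        unfolding matrix_vector_mult_def
        by (intro continuous_on_vec_lambda continuous_on_sum continuous_on_mult continuous_on_component continuous_on_id)
    qed
    moreover have "continuous_on A (\<lambda>x. R *v G x)"
      by (rule continuous_on_compose2[OF matrix_vector_mult_linear_continuous_on contG]) auto
    moreover have "continuous_on A (\<lambda>x. M *v x)"
      by (rule matrix_vector_mult_linear_continuous_on)
    ultimately show ?thesis unfolding F_def by (intro continuous_intros)
  qed
  have "\<exists>x. F x = 0"
  proof (rule ccontr)
    assume no: "\<nexists>x. F x = 0"
    \<comment> \<open>Without a zero, \<open>- F\<close> can be normalised to length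
      \<open>\<rho>\<close>. A fixed point \<open>x\<close> of the result lies on the sphere and has
      \<open>F x \<bullet> x\<close> negative, against \<open>pos\<close>.\<close>
    define g where "g x = (- \<rho> / norm (F x)) *\<^sub>R F x" for x
    have normg: "norm (g x) = \<rho>" for x using no \<rho> by (auto simp: g_def)
    have "continuous_on (cball 0 \<rho>) g"
      unfolding g_def using no contF by (intro continuous_intros) auto
    moreover have "g \<in> cball 0 \<rho> \<rightarrow> cball 0 \<rho>" using normg by auto
    ultimately obtain x where x: "g x = x"
      using brouwer_ball[OF \<rho>, of 0 g] by (auto simp: image_subset_iff_funcset)
    then have "norm x = \<rho>" using normg[of x] by simp
    from pos[OF this] have "F x \<bullet> x > 0" .
    moreover have "F x \<bullet> x = - \<rho> * norm (F x)"
    proof -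
      have "F x \<bullet> x = F x \<bullet> g x" using x by simp
      also have "\<dots> = - \<rho> * norm (F x)"
        using no by (simp add: g_def dot_square_norm power2_eq_square)
      finally show ?thesis .
    qed
    ultimately show False using \<rho> by (smt (verit) mult_nonneg_nonneg norm_ge_zero minus_mult_left)
  qed
  then obtain x where "F x = 0" by blast
  then have "implicit_step L \<phi> p \<tau> U W (G x) x"
    using K0 KG by (simp add: implicit_step_iff F_def)
  then show ?thesis by blast
qed

section \<open>Contraction and convergence of the Newton iteration\<close>

lemma newton_step_contracts:
  assumes exact: "implicit_step L \<phi> p \<tau> U W U' W'"
    and newton: "newton_step L \<phi> p \<tau> W Uk Wk Ux Wx"
    and tau: "0 < \<tau>" and small: "\<tau> * (2 * P + C * N W' + C * \<epsilon>) \<le> 1 / 2"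
    and close: "N (Ux - Uk) \<le> \<epsilon>"
  shows "N (Wx - W') \<le> N (Wk - W') / 2"
proof -
  define a b b0 where "a = Ux - U'" and "b = Wx - W'" and "b0 = Wk - W'"
  have eqE: "M *v W' + \<tau> *\<^sub>R (S U' *v W') - \<tau> *\<^sub>R (R *v U') = M *v W"
    using exact by (simp add: implicit_step_iff)
  have eqN: "\<tau> *\<^sub>R (S Ux *v Wk) - \<tau> *\<^sub>R (R *v Ux) + M *v Wx + \<tau> *\<^sub>R (S Uk *v Wx) = \<tau> *\<^sub>R (S Uk *v Wk) + M *v W"
    using newton by (simp add: newton_step_iff)
  have K: "K *v a = M *v b"
    using exact newton by (simp add: implicit_step_iff newton_step_iff a_def b_def matrix_vector_mult_diff_distrib)
  \<comment> \<open>Exact expansion of the advection terms around \<open>(U', W')\<close>. The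
    linearisation defect is written with the increment \<open>Ux - Uk\<close> instead of the error
    \<open>Uk - U'\<close>, because the tolerance controls the increment.\<close>
  have split: "S Ux *v Wk + S Uk *v Wx - S Uk *v Wk - S U' *v W' = S a *v W' + S Uk *v b + S (Ux - Uk) *v b0"
    by (simp add: a_def b_def b0_def S_diff matrix_vector_mult_diff_distrib)
  have "M *v b + \<tau> *\<^sub>R (S a *v W' + S Uk *v b + S (Ux - Uk) *v b0) - \<tau> *\<^sub>R (R *v a) = 0"
    using eqE eqN unfolding split[symmetric]
    by (simp add: a_def b_def matrix_vector_mult_diff_distrib algebra_simps)
  from arg_cong[OF this, of "\<lambda>v. b \<bullet> v"]
  have "(N b)\<^sup>2 + \<tau> * (b \<bullet> (S a *v W')) + \<tau> * (b \<bullet> (S (Ux - Uk) *v b0)) - \<tau> * (b \<bullet> (R *v a)) = 0"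
    by (simp add: inner_add_right inner_diff_right S_skew N_sq distrib_left)
  moreover have "\<tau> * (b \<bullet> (R *v a)) \<le> \<tau> * (2 * P * N b * N b)"
    using R_bound'[OF K, of b] tau by (intro mult_left_mono) auto
  moreover have "\<tau> * - (b \<bullet> (S a *v W')) \<le> \<tau> * (C * N b * N W' * N b)"
  proof (intro mult_left_mono)
    have "- (b \<bullet> (S a *v W')) \<le> C * N a * N W' * N b" using S_bound[of b a W'] by linarith
    also have "\<dots> \<le> C * N b * N W' * N b"
      using N_le[OF K] by (intro mult_right_mono mult_left_mono) (auto simp: C_nonneg N_nonneg)
    finally show "- (b \<bullet> (S a *v W')) \<le> C * N b * N W' * N b" .
  qed (use tau in simp)
  moreover have "\<tau> * - (b \<bullet> (S (Ux - Uk) *v b0)) \<le> \<tau> * (C * \<epsilon> * N b0 * N b)"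
  proof (intro mult_left_mono)
    have "- (b \<bullet> (S (Ux - Uk) *v b0)) \<le> C * N (Ux - Uk) * N b0 * N b" using S_bound[of b "Ux - Uk" b0] by linarith
    also have "\<dots> \<le> C * \<epsilon> * N b0 * N b"
      using close by (intro mult_right_mono mult_left_mono) (auto simp: C_nonneg N_nonneg)
    finally show "- (b \<bullet> (S (Ux - Uk) *v b0)) \<le> C * \<epsilon> * N b0 * N b" .
  qed (use tau in simp)
  ultimately have "N b * ((1 - \<tau> * (2 * P + C * N W')) * N b) \<le> N b * (\<tau> * (C * \<epsilon>) * N b0)"
    by (simp add: power2_eq_square algebra_simps)
  \<comment> \<open>\<open>A\<close> is the share of the budget 1/2 taken by the increment; the
    factor in front of \<open>N b\<close> on the left is then at least
    \<open>1 / 2 + A\<close>.\<close>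
  moreover define A where "A = \<tau> * (C * \<epsilon>)"
  have "0 \<le> \<epsilon>" using close N_nonneg[of "Ux - Uk"] by linarith
  then have A: "0 \<le> A" using tau C_nonneg by (simp add: A_def)
  have A2: "\<tau> * (2 * P + C * N W') \<le> 1 / 2 - A" using small by (simp add: A_def algebra_simps)
  moreover have "A \<le> 1 / 2"
  proof -
    have "0 \<le> \<tau> * (2 * P + C * N W')" using tau C_nonneg P_nonneg N_nonneg[of W'] by simp
    with A2 show ?thesis by linarith
  qed
  ultimately have *: "N b * ((1 - \<tau> * (2 * P + C * N W')) * N b) \<le> N b * (A * N b0)" by (simp add: A_def)
  show ?thesis
  proof (cases "N b = 0")
    case False
    with N_nonneg[of b] have "N b > 0" by simp
    with * have "(1 - \<tau> * (2 * P + C * N W')) * N b \<le> A * N b0" by (simp add: mult_le_cancel_left)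
    moreover have "(1 / 2 + A) * N b \<le> (1 - \<tau> * (2 * P + C * N W')) * N b"
      using A2 \<open>N b > 0\<close> by (intro mult_right_mono) auto
    ultimately have 1: "(1 / 2 + A) * N b \<le> A * N b0" by linarith
    \<comment> \<open>The ratio \<open>A / (1 / 2 + A)\<close> increases with \<open>A\<close> and
      equals 1/2 at \<open>A = 1 / 2\<close>, which gives the contraction factor.\<close>
    have "A * N b0 \<le> (1 / 2 + A) / 2 * N b0"
      using \<open>A \<le> 1 / 2\<close> N_nonneg[of b0] by (intro mult_right_mono) auto
    with 1 have "(1 / 2 + A) * N b \<le> (1 / 2 + A) * (N b0 / 2)" by (simp add: algebra_simps)
    then have "N b \<le> N b0 / 2" using A by (subst (asm) mult_le_cancel_left_pos) auto
    then show ?thesis by (simp add: b_def b0_def)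
  qed (use N_nonneg[of "Wk - W'"] in \<open>simp add: b_def\<close>)
qed

lemma newton_converges:
  assumes exact: "implicit_step L \<phi> p \<tau> U W U' W'"
    and newton: "newton_iterates L \<phi> p \<tau> U W NU NW"
    and tau: "0 < \<tau>" and small: "\<tau> * (2 * P + C * N W' + C * \<epsilon>) \<le> 1 / 2"
    and close: "\<And>k. k \<ge> k0 \<Longrightarrow> N (NU (Suc k) - NU k) \<le> \<epsilon>"
  shows "(\<lambda>k. N (NU k - U')) \<longlonglongrightarrow> 0" and "(\<lambda>k. N (NW k - W')) \<longlonglongrightarrow> 0"
proof -
  have step: "newton_step L \<phi> p \<tau> W (NU k) (NW k) (NU (Suc k)) (NW (Suc k))" for k
    using newton by (simp add: newton_iterates_def)
  have geo: "N (NW (k0 + j) - W') \<le> (1 / 2) ^ j * N (NW k0 - W')" for j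
  proof (induction j)
    case (Suc j)
    have "N (NW (Suc (k0 + j)) - W') \<le> N (NW (k0 + j) - W') / 2"
      by (rule newton_step_contracts[OF exact step tau small close]) simp
    with Suc show ?case by simp
  qed simp
  have lim: "(\<lambda>j. (1 / 2) ^ j * N (NW k0 - W')) \<longlonglongrightarrow> 0"
    by (intro tendsto_mult_left_zero LIMSEQ_realpow_zero) auto
  have "(\<lambda>j. N (NW (j + k0) - W')) \<longlonglongrightarrow> 0"
    using geo by (intro tendsto_sandwich[OF _ _ tendsto_const lim] always_eventually allI)
      (simp_all add: N_nonneg add.commute[of _ k0])
  then show W: "(\<lambda>k. N (NW k - W')) \<longlonglongrightarrow> 0"
    by (rule LIMSEQ_offset)
  \<comment> \<open>The elliptic relation for an iterate is read off from the Newton step that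
    produced it, hence \<open>k \<ge> 1\<close>; the limit does not notice.\<close>
  have le: "N (NU k - U') \<le> N (NW k - W')" if k1: "k \<ge> 1" for k
  proof (rule N_le)
    obtain j where "k = Suc j" using k1 by (cases k) auto
    with step[of j] exact show "K *v (NU k - U') = M *v (NW k - W')"
      by (simp add: implicit_step_iff newton_step_iff matrix_vector_mult_diff_distrib)
  qed
  have "\<forall>\<^sub>F k in sequentially. N (NU k - U') \<le> N (NW k - W')"
    using le unfolding eventually_sequentially by blast
  then show "(\<lambda>k. N (NU k - U')) \<longlonglongrightarrow> 0"
    by (rule tendsto_sandwich[OF always_eventually _ tendsto_const W, rotated]) (simp add: N_nonneg)
qed

end

section \<open>Square integrable and bounded functions\<close>

lemma L2_fun_mult_integrable:
  assumes "L2_fun S f" "L2_fun S g"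
  shows "integrable (lebesgue_on S) (\<lambda>z. f z * g z)"
proof (rule Bochner_Integration.integrable_bound[where f = "\<lambda>z. (f z)\<^sup>2 + (g z)\<^sup>2"])
  show "integrable (lebesgue_on S) (\<lambda>z. (f z)\<^sup>2 + (g z)\<^sup>2)"
    "(\<lambda>z. f z * g z) \<in> borel_measurable (lebesgue_on S)"
    using assms by (auto simp: L2_fun_def)
  have "\<bar>f z * g z\<bar> \<le> \<bar>(f z)\<^sup>2 + (g z)\<^sup>2\<bar>" for z
  proof -
    have "2 * (\<bar>f z\<bar> * \<bar>g z\<bar>) \<le> (f z)\<^sup>2 + (g z)\<^sup>2"
      using sum_squares_bound[of "\<bar>f z\<bar>" "\<bar>g z\<bar>"] by simp
    moreover have "0 \<le> \<bar>f z\<bar> * \<bar>g z\<bar>" by simp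
    ultimately show ?thesis unfolding abs_mult by linarith
  qed
  then show "AE z in lebesgue_on S. norm (f z * g z) \<le> norm ((f z)\<^sup>2 + (g z)\<^sup>2)" by simp
qed

lemma L2_fun_lincomb:
  assumes "L2_fun S f" "L2_fun S g"
  shows "L2_fun S (\<lambda>z. f z + c * g z)"
proof -
  have "(\<lambda>z. (f z + c * g z)\<^sup>2) = (\<lambda>z. (f z)\<^sup>2 + 2 * c * (f z * g z) + c\<^sup>2 * (g z)\<^sup>2)"
    by (auto simp: power2_eq_square algebra_simps)
  moreover have "integrable (lebesgue_on S) \<dots>"
    using assms L2_fun_mult_integrable[OF assms]
    by (intro Bochner_Integration.integrable_add integrable_mult_right) (auto simp: L2_fun_def)
  ultimately show ?thesis using assms by (auto simp: L2_fun_def)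
qed

lemma L2_inner_Cauchy_Schwarz:
  assumes "L2_fun S f" "L2_fun S g"
  shows "\<bar>L2_inner S f g\<bar> \<le> L2_norm S f * L2_norm S g"
proof -
  have ff: "integrable (lebesgue_on S) (\<lambda>z. f z * f z)" and gg: "integrable (lebesgue_on S) (\<lambda>z. g z * g z)"
    and fg: "integrable (lebesgue_on S) (\<lambda>z. f z * g z)"
    using assms by (auto intro: L2_fun_mult_integrable)
  have "0 \<le> L2_inner S f f + 2 * t * L2_inner S f g + t\<^sup>2 * L2_inner S g g" for t
  proof -
    have "L2_inner S f f + 2 * t * L2_inner S f g + t\<^sup>2 * L2_inner S g g
        = (LINT z|lebesgue_on S. f z * f z + 2 * t * (f z * g z) + t\<^sup>2 * (g z * g z))"
      unfolding L2_inner_def using ff gg fg by simp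
    also have "\<dots> = (LINT z|lebesgue_on S. (f z + t * g z)\<^sup>2)"
      by (intro Bochner_Integration.integral_cong) (auto simp: power2_eq_square algebra_simps)
    also have "\<dots> \<ge> 0" by simp
    finally show ?thesis .
  qed
  then show ?thesis unfolding L2_norm_def by (rule discriminant_bound)
qed

lemma L2_norm_nonneg: "0 \<le> L2_norm S f"
  by (simp add: L2_norm_def L2_inner_def)

lemma L2_norm_sq: "(L2_norm S f)\<^sup>2 = L2_inner S f f"
  by (simp add: L2_norm_def L2_inner_def)

text \<open>Trades the extended-real essential supremum for an explicit real bound, so that closure
  under algebraic operations becomes arithmetic with bounds.\<close>

lemma Linf_fun_iff:
  "Linf_fun S f \<longleftrightarrow> f \<in> borel_measurable (lebesgue_on S) \<and> (\<exists>B. AE z in lebesgue_on S. \<bar>f z\<bar> \<le> B)"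
proof
  assume f: "Linf_fun S f"
  let ?m = "Linf_norm S f"
  have "AE z in lebesgue_on S. ereal \<bar>f z\<bar> \<le> ?m"
    unfolding Linf_norm_def by (rule esssup_AE)
  moreover have "\<bar>r\<bar> \<le> real_of_ereal ?m" if "ereal \<bar>r\<bar> \<le> ?m" for r
    using that f by (cases ?m) (auto simp: Linf_fun_def)
  ultimately have "AE z in lebesgue_on S. \<bar>f z\<bar> \<le> real_of_ereal ?m"
    by (auto elim: eventually_mono)
  with f show "f \<in> borel_measurable (lebesgue_on S) \<and> (\<exists>B. AE z in lebesgue_on S. \<bar>f z\<bar> \<le> B)"
    by (auto simp: Linf_fun_def)
next
  assume "f \<in> borel_measurable (lebesgue_on S) \<and> (\<exists>B. AE z in lebesgue_on S. \<bar>f z\<bar> \<le> B)"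
  then obtain B where f: "f \<in> borel_measurable (lebesgue_on S)" and B: "AE z in lebesgue_on S. \<bar>f z\<bar> \<le> B" by blast
  have "Linf_norm S f \<le> ereal B"
    unfolding Linf_norm_def using f B by (intro esssup_I) auto
  then show "Linf_fun S f" using f by (auto simp: Linf_fun_def)
qed

lemma Linf_fun_measurable: "Linf_fun S f \<Longrightarrow> f \<in> borel_measurable (lebesgue_on S)"
  by (simp add: Linf_fun_def)

lemma Linf_fun_bound:
  assumes "Linf_fun S f" obtains B where "0 \<le> B" "AE z in lebesgue_on S. \<bar>f z\<bar> \<le> B"
proof -
  obtain B where "AE z in lebesgue_on S. \<bar>f z\<bar> \<le> B" using assms by (auto simp: Linf_fun_iff)
  then have "AE z in lebesgue_on S. \<bar>f z\<bar> \<le> max 0 B" by (auto elim: eventually_mono)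
  then show ?thesis using that[of "max 0 B"] by simp
qed

lemma Linf_fun_const: "Linf_fun S (\<lambda>z. c)"
  by (auto simp: Linf_fun_iff)

lemma Linf_fun_add:
  assumes "Linf_fun S f" "Linf_fun S g" shows "Linf_fun S (\<lambda>z. f z + g z)"
proof -
  obtain B C where "AE z in lebesgue_on S. \<bar>f z\<bar> \<le> B" "AE z in lebesgue_on S. \<bar>g z\<bar> \<le> C"
    using assms by (auto simp: Linf_fun_iff)
  then have "AE z in lebesgue_on S. \<bar>f z + g z\<bar> \<le> B + C"
    by eventually_elim linarith
  then show ?thesis using assms by (auto simp: Linf_fun_iff)
qed

lemma Linf_fun_mult:
  assumes "Linf_fun S f" "Linf_fun S g" shows "Linf_fun S (\<lambda>z. f z * g z)"
proof -
  obtain B where B: "0 \<le> B" "AE z in lebesgue_on S. \<bar>f z\<bar> \<le> B" using Linf_fun_bound[OF assms(1)] .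
  obtain C where C: "0 \<le> C" "AE z in lebesgue_on S. \<bar>g z\<bar> \<le> C" using Linf_fun_bound[OF assms(2)] .
  have "AE z in lebesgue_on S. \<bar>f z * g z\<bar> \<le> B * C"
    using B(2) C(2) by eventually_elim (use B(1) in \<open>auto simp: abs_mult intro!: mult_mono\<close>)
  then show ?thesis using assms by (auto simp: Linf_fun_iff)
qed

lemma Linf_fun_minus: "Linf_fun S f \<Longrightarrow> Linf_fun S (\<lambda>z. - f z)"
  using Linf_fun_mult[OF Linf_fun_const[of S "-1"]] by simp

lemma Linf_fun_sum: "(\<And>i. i \<in> I \<Longrightarrow> Linf_fun S (f i)) \<Longrightarrow> Linf_fun S (\<lambda>z. \<Sum>i\<in>I. f i z)"
  by (induction I rule: infinite_finite_induct) (auto intro: Linf_fun_const Linf_fun_add)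

lemma Linf_fun_power: "Linf_fun S f \<Longrightarrow> Linf_fun S (\<lambda>z. f z ^ k)"
  by (induction k) (auto intro: Linf_fun_const Linf_fun_mult)

lemmas Linf_intros = Linf_fun_const Linf_fun_add Linf_fun_mult Linf_fun_minus Linf_fun_sum Linf_fun_power

lemma Linf_fun_integrable:
  assumes "S \<in> lmeasurable" "Linf_fun S f"
  shows "integrable (lebesgue_on S) f"
proof -
  interpret finite_measure "lebesgue_on S" using assms(1) by (rule finite_measure_lebesgue_on)
  obtain B where "AE z in lebesgue_on S. \<bar>f z\<bar> \<le> B" using assms by (auto simp: Linf_fun_iff)
  then show ?thesis using Linf_fun_measurable[OF assms(2)]
    by (intro integrable_const_bound[where B = B]) auto
qed

lemma Linf_fun_imp_L2_fun:
  assumes "S \<in> lmeasurable" "Linf_fun S f"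
  shows "L2_fun S f"
  using assms Linf_fun_power[of S f 2] by (simp add: L2_fun_def Linf_fun_integrable Linf_fun_measurable)

lemma AE_lebesgue_onI:
  assumes "S \<in> sets lebesgue" "negligible N" "\<And>z. z \<in> S \<Longrightarrow> z \<notin> N \<Longrightarrow> P z"
  shows "AE z in lebesgue_on S. P z"
proof -
  have "AE z in lebesgue. z \<notin> N"
    using assms(2) by (simp add: negligible_iff_null_sets AE_not_in)
  then have "AE z in lebesgue. z \<in> S \<longrightarrow> P z" using assms(3) by (auto elim: eventually_mono)
  then show ?thesis using assms(1) by (simp add: AE_restrict_space_iff)
qed

text \<open>Lebesgue measure is complete: whatever \<open>f\<close> does on the null set
  \<open>S - T\<close>, its preimages there are measurable. The case of interest has the square as
  \<open>S\<close> and the union of the open triangles as \<open>T\<close>.\<close>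

lemma borel_measurable_spike:
  fixes f :: "'a::euclidean_space \<Rightarrow> real"
  assumes "S \<in> sets lebesgue" "T \<in> sets lebesgue" "negligible (S - T)"
    and f: "f \<in> borel_measurable (lebesgue_on T)"
  shows "f \<in> borel_measurable (lebesgue_on S)"
proof (rule measurableI)
  fix A :: "real set" assume A: "A \<in> sets borel"
  have "f -` A \<inter> T \<in> sets (lebesgue_on T)"
    using measurable_sets[OF f A] by simp
  then have "f -` A \<inter> T \<in> sets lebesgue" using assms(2) by (simp add: sets_restrict_space_iff)
  moreover have "f -` A \<inter> (S - T) \<in> sets lebesgue"
    using assms(3) by (intro negligible_imp_sets negligible_subset[OF assms(3)]) auto
  ultimately have "(f -` A \<inter> T) \<inter> S \<union> f -` A \<inter> (S - T) \<in> sets lebesgue" using assms(1) by auto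
  moreover have "(f -` A \<inter> T) \<inter> S \<union> f -` A \<inter> (S - T) = f -` A \<inter> S" by auto
  ultimately show "f -` A \<inter> space (lebesgue_on S) \<in> sets (lebesgue_on S)"
    using assms(1) by (simp add: sets_restrict_space_iff)
qed simp

section \<open>Exact integration of affine functions between two lines\<close>

lemma integral_Simpson:
  fixes a b c0 c1 c2 :: real and q :: "real \<Rightarrow> real"
  assumes ab: "a \<le> b" and q: "\<And>s. q s = c0 + c1 * s + c2 * s\<^sup>2"
  shows "(LINT s|lborel. indicator {a<..<b} s * q s) = (b - a) / 6 * (q a + 4 * q ((a + b) / 2) + q b)"
proof -
  have "(LINT s|lborel. indicator {a<..<b} s * q s) = (LINT s|lborel. indicator {a..b} s *\<^sub>R q s)"
  proof (rule integral_cong_AE)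
    show "AE s in lborel. indicator {a<..<b} s * q s = indicator {a..b} s *\<^sub>R q s"
      using AE_lborel_singleton[of a] AE_lborel_singleton[of b]
      by eventually_elim (auto simp: indicator_def)
  qed (auto simp: q[abs_def])
  also have "\<dots> = (c0 * b + c1 * b\<^sup>2 / 2 + c2 * b ^ 3 / 3) - (c0 * a + c1 * a\<^sup>2 / 2 + c2 * a ^ 3 / 3)"
  proof (rule integral_FTC_atLeastAtMost[OF ab])
    fix s
    have "((\<lambda>b. c0 * b + c1 * b\<^sup>2 / 2 + c2 * b ^ 3 / 3) has_real_derivative q s) (at s within {a..b})"
      by (auto simp: q power2_eq_square field_simps power3_eq_cube intro!: derivative_eq_intros)
    then show "((\<lambda>b. c0 * b + c1 * b\<^sup>2 / 2 + c2 * b ^ 3 / 3) has_vector_derivative q s) (at s within {a..b})"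
      by (simp add: has_real_derivative_iff_has_vector_derivative)
  next
    show "continuous_on {a..b} q" unfolding q[abs_def] by (intro continuous_intros)
  qed
  also have "\<dots> = (b - a) / 6 * (q a + 4 * q ((a + b) / 2) + q b)"
    by (simp add: q power2_eq_square power3_eq_cube field_simps)
  finally show ?thesis .
qed

text \<open>Integrating first in the vertical direction gives the length of the segment times the
  integrand at its midpoint. This is \<open>q\<close>, a quadratic in the first coordinate, for
  which Simpson's rule is exact. Stating the result through three values of \<open>q\<close> lets
  corner values appear later.\<close>

lemma integral_affine_between:
  fixes a b c e l0 l1 r0 r1 \<alpha> \<beta> \<gamma> :: real
  defines "l \<equiv> \<lambda>s. l0 + l1 * s" and "r \<equiv> \<lambda>s. r0 + r1 * s"
  assumes ab: "a \<le> b" and lr: "\<And>s. a < s \<Longrightarrow> s < b \<Longrightarrow> c \<le> l s \<and> l s \<le> r s \<and> r s \<le> e"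
  defines "T \<equiv> {z. a < fst z \<and> fst z < b \<and> l (fst z) < snd z \<and> snd z < r (fst z)}"
    and "q \<equiv> \<lambda>s. (r s - l s) * (\<alpha> + \<beta> * s + \<gamma> * ((l s + r s) / 2))"
  shows "(LINT z|lebesgue_on T. \<alpha> + \<beta> * fst z + \<gamma> * snd z) = (b - a) / 6 * (q a + 4 * q ((a + b) / 2) + q b)"
proof -
  have "open T" unfolding T_def l_def r_def
    by (intro open_Collect_conj open_Collect_less continuous_intros)
  then have T: "T \<in> sets borel" by simp
  let ?g = "\<lambda>z. \<alpha> + \<beta> * fst z + \<gamma> * snd z :: real"
  let ?f = "\<lambda>z. indicator T z * ?g z"
  have f: "?f \<in> borel_measurable lborel" 
    using T by (intro borel_measurable_times borel_measurable_indicator) (auto intro!: borel_measurable_continuous_onI continuous_intros)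
  have "(LINT z|lebesgue_on T. ?g z) = (LINT z|lebesgue. ?f z)"
    using T by (subst integral_restrict_space) auto
  also have "\<dots> = (LINT z|lborel. ?f z)" using f by (rule integral_completion)
  also have "\<dots> = (LINT z|(lborel \<Otimes>\<^sub>M lborel). ?f z)" by (simp add: lborel_prod)
  also have "\<dots> = (LINT s|lborel. LINT t|lborel. ?f (s, t))"
  proof -
    \<comment> \<open>Fubini needs integrability: the bounds \<open>c\<close> and \<open>e\<close>
      place the region in a compact rectangle, on which the integrand is continuous.\<close>
    have "compact ({a..b} \<times> {c..e})" by (intro compact_Times) auto
    then have "integrable lborel (\<lambda>z. indicator ({a..b} \<times> {c..e}) z *\<^sub>R ?g z)"
      by (intro borel_integrable_compact continuous_intros)
    then have "integrable lborel (\<lambda>z. indicator T z *\<^sub>R (indicator ({a..b} \<times> {c..e}) z *\<^sub>R ?g z))"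
      by (rule integrable_mult_indicator[rotated]) (use T in simp)
    moreover have "(\<lambda>z. indicator T z *\<^sub>R (indicator ({a..b} \<times> {c..e}) z *\<^sub>R ?g z)) = ?f"
      using lr by (force simp: T_def indicator_def fun_eq_iff)
    ultimately have "integrable (lborel \<Otimes>\<^sub>M lborel) ?f" by (simp add: lborel_prod)
    from lborel_pair.integral_fst'[OF this] show ?thesis by simp
  qed
  also have "\<dots> = (LINT s|lborel. indicator {a<..<b} s * q s)"
  proof (rule Bochner_Integration.integral_cong[OF refl])
    fix s :: real
    show "(LINT t|lborel. ?f (s, t)) = indicator {a<..<b} s * q s"
    proof (cases "a < s \<and> s < b")
      case True
      then have "(LINT t|lborel. ?f (s, t)) = (LINT t|lborel. indicator {l s<..<r s} t * (\<alpha> + \<beta> * s + \<gamma> * t))"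
        by (intro Bochner_Integration.integral_cong) (auto simp: T_def indicator_def)
      \<comment> \<open>With quadratic coefficient 0, Simpson's rule collapses to the midpoint
        rule.\<close>
      also have "(LINT t|lborel. indicator {l s<..<r s} t * (\<alpha> + \<beta> * s + \<gamma> * t)) = q s"
        using lr[of s] True
        by (subst integral_Simpson[where ?c0.0 = "\<alpha> + \<beta> * s" and ?c1.0 = \<gamma> and ?c2.0 = 0])
          (auto simp: q_def field_simps)
      finally show ?thesis using True by simp
    qed (auto simp: T_def indicator_def)
  qed
  also have "\<dots> = (b - a) / 6 * (q a + 4 * q ((a + b) / 2) + q b)"
  proof (rule integral_Simpson[OF ab])
    fix s
    show "q s = (r0 - l0) * (\<alpha> + \<gamma> * (l0 + r0) / 2)
        + ((r1 - l1) * (\<alpha> + \<gamma> * (l0 + r0) / 2) + (r0 - l0) * (\<beta> + \<gamma> * (l1 + r1) / 2)) * s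
        + (r1 - l1) * (\<beta> + \<gamma> * (l1 + r1) / 2) * s\<^sup>2"
      by (simp add: q_def l_def r_def field_simps power2_eq_square)
  qed
  finally show ?thesis .
qed

section \<open>The triangulation\<close>

lemma square_eq_box: "square L = box (0, 0) (L, L)"
  by (auto simp: square_def box_def Basis_prod_def)

lemma lmeasurable_square: "square L \<in> lmeasurable"
  by (simp add: square_eq_box)

lemma sets_square: "square L \<in> sets lebesgue"
  using lmeasurable_square by (rule fmeasurableD)

lemma open_square: "open (square L)"
  by (simp add: square_eq_box open_box)

lemma grid_less:
  assumes "grid_points L n x" "i < j" "j \<le> n - 1" shows "x i < x j"
  using assms(2,3)
proof (induction j)
  case (Suc j)
  have "x j < x (Suc j)" using assms(1) Suc.prems by (simp add: grid_points_def)
  with Suc show ?case by (cases "i = j") auto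
qed simp

lemma grid_range:
  assumes "grid_points L n x" "i \<le> n - 1" shows "x i \<in> {0..L}"
proof -
  have "x 0 = 0" "x (n - 1) = L" using assms by (auto simp: grid_points_def)
  then show ?thesis
    using grid_less[OF assms(1), of 0 i] grid_less[OF assms(1), of i "n - 1"] assms(2)
    by (cases "i = 0"; cases "i = n - 1") auto
qed

lemma grid_locate:
  assumes "grid_points L n x" "0 < s" "s < L" "\<And>i. i \<le> n - 1 \<Longrightarrow> s \<noteq> x i"
  shows "\<exists>i<n - 1. x i < s \<and> s < x (Suc i)"
proof -
  have "\<exists>i<k. x i < s \<and> s < x (Suc i)" if "s < x k" "k \<le> n - 1" for k
    using that
  proof (induction k)
    case 0
    then show ?case using assms(1,2) by (simp add: grid_points_def)
  next
    case (Suc k)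
    then show ?case
      using assms(4)[of k] by (cases "s < x k") (auto intro: less_SucI)
  qed
  from this[of "n - 1"] show ?thesis using assms(1,3) by (simp add: grid_points_def)
qed

lemma grid_interval_unique:
  assumes "grid_points L n x" "i < n - 1" "i' < n - 1"
    and "x i < s" "s < x (Suc i)" "x i' < s" "s < x (Suc i')"
  shows "i = i'"
proof -
  have "x (Suc i) \<le> x i'" if "i < i'" "i' < n - 1" for i i'
    using grid_less[OF assms(1), of "Suc i" i'] that by (cases "Suc i = i'") auto
  then show ?thesis using assms by (metis less_asym less_le_trans linorder_neqE_nat)
qed

lemma in_triangleI:
  fixes a b c z :: "real \<times> real"
  assumes "z = u *\<^sub>R a + v *\<^sub>R b + w *\<^sub>R c" "0 \<le> u" "0 \<le> v" "0 \<le> w" "u + v + w = 1"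
  shows "z \<in> convex hull {a, b, c}"
  using assms by (auto simp: convex_hull_3)

locale rect_grid =
  fixes L :: real and n :: nat and x y :: "nat \<Rightarrow> real" and d :: "nat \<Rightarrow> nat \<Rightarrow> bool"
  assumes grid_x: "grid_points L n x" and grid_y: "grid_points L n y"
begin

abbreviation "\<T> \<equiv> structured_triangulation n x y d"

lemma step_pos:
  "i < n - 1 \<Longrightarrow> x i < x (Suc i)" "j < n - 1 \<Longrightarrow> y j < y (Suc j)"
  using grid_x grid_y by (auto simp: grid_points_def)

text \<open>Writes the cut as a graph over the first coordinate, rising or falling with
  \<open>d i j\<close>, so that both triangles of a cell are regions between two affine
  graphs.\<close>

definition diagonal :: "nat \<Rightarrow> nat \<Rightarrow> real \<Rightarrow> real" where
  "diagonal i j s = (let r = (s - x i) / (x (Suc i) - x i) * (y (Suc j) - y j)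
     in if d i j then y j + r else y (Suc j) - r)"

lemma diagonal_affine:
  "diagonal i j s = (if d i j then y j else y (Suc j))
     + (if d i j then 1 else - 1) * ((y (Suc j) - y j) / (x (Suc i) - x i)) * (s - x i)"
  by (simp add: diagonal_def Let_def diff_divide_distrib algebra_simps)

text \<open>The interiors of the triangles, indexed by cell and by the side of the diagonal.
  Openness gives finite element functions classical derivatives at every point of a half, and what
  is left of the square is a null set.\<close>

definition half :: "nat \<times> nat \<times> bool \<Rightarrow> (real \<times> real) set" where
  "half = (\<lambda>(i, j, up). {z. x i < fst z \<and> fst z < x (Suc i) \<and>
     (if up then diagonal i j (fst z) else y j) < snd z \<and>
     snd z < (if up then y (Suc j) else diagonal i j (fst z))})"

text \<open>Counterclockwise.\<close>

fun corners :: "nat \<times> nat \<times> bool \<Rightarrow> (real \<times> real) list" where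
  "corners (i, j, up) =
     (let sw = (x i, y j); se = (x (Suc i), y j); nw = (x i, y (Suc j)); ne = (x (Suc i), y (Suc j))
      in if d i j then (if up then [sw, ne, nw] else [sw, se, ne])
         else (if up then [se, ne, nw] else [sw, se, nw]))"

definition halves :: "(nat \<times> nat \<times> bool) set" where
  "halves = {..<n - 1} \<times> {..<n - 1} \<times> UNIV"

lemma finite_halves: "finite halves"
  by (simp add: halves_def)

lemma continuous_on_diagonal [continuous_intros]:
  "continuous_on A f \<Longrightarrow> continuous_on A (\<lambda>z. diagonal i j (f z))"
  unfolding diagonal_affine by (intro continuous_intros)

lemma open_half: "open (half t)"
proof -
  obtain i j up where "t = (i, j, up)" by (cases t) auto
  then show ?thesis unfolding half_def
    by (cases up) (auto intro!: open_Collect_conj open_Collect_less continuous_intros)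
qed

lemma sets_half: "half t \<in> sets lebesgue"
  using open_half[of t] by auto

lemma diagonal_range:
  assumes "(i, j, up) \<in> halves" "x i \<le> s" "s \<le> x (Suc i)"
  shows "y j \<le> diagonal i j s \<and> diagonal i j s \<le> y (Suc j)"
proof -
  have w: "x i < x (Suc i)" and h: "y j < y (Suc j)" using assms step_pos by (auto simp: halves_def)
  define r where "r = (s - x i) / (x (Suc i) - x i)"
  have r: "0 \<le> r" "r \<le> 1" using w assms by (auto simp: r_def)
  have "diagonal i j s = (if d i j then y j + (y (Suc j) - y j) * r else y (Suc j) - (y (Suc j) - y j) * r)"
    by (simp add: diagonal_def Let_def r_def mult.commute)
  moreover have "0 \<le> (y (Suc j) - y j) * r" "(y (Suc j) - y j) * r \<le> (y (Suc j) - y j) * 1"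
    using r h by (auto intro: mult_left_mono)
  ultimately show ?thesis by (auto simp: algebra_simps)
qed

lemma half_coords:
  assumes t: "(i, j, up) \<in> halves" and z: "z \<in> half (i, j, up)"
  obtains r s where "z = (x i + r * (x (Suc i) - x i), y j + s * (y (Suc j) - y j))"
    "0 < r" "r < 1" "0 < s" "s < 1"
    "if d i j then (if up then r < s else s < r) else (if up then 1 < r + s else r + s < 1)"
proof -
  define w h where "w = x (Suc i) - x i" and "h = y (Suc j) - y j"
  have wh: "0 < w" "0 < h" using t step_pos by (auto simp: halves_def w_def h_def)
  define r s where "r = (fst z - x i) / w" and "s = (snd z - y j) / h"
  have z_eq: "fst z = x i + r * w" "snd z = y j + s * h" using wh by (auto simp: r_def s_def)
  have r: "0 < r" "r < 1"
    using z wh by (auto simp: half_def r_def w_def split: if_splits)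
  have diag: "diagonal i j (fst z) = (if d i j then y j + r * h else y j + (1 - r) * h)"
    by (simp add: diagonal_def Let_def r_def h_def w_def algebra_simps)
  have "y j < snd z" "snd z < y (Suc j)"
    using diagonal_range[OF t, of "fst z"] z by (auto simp: half_def split: if_splits)
  then have s: "0 < s" "s < 1" using wh by (auto simp: s_def h_def)
  have "if d i j then (if up then r < s else s < r) else (if up then 1 < r + s else r + s < 1)"
  proof -
    have "if up then (if d i j then r * h < s * h else (1 - r) * h < s * h)
        else (if d i j then s * h < r * h else s * h < (1 - r) * h)"
      using z diag by (auto simp: half_def z_eq split: if_splits)
    then show ?thesis using wh by (auto split: if_splits)
  qed
  with r s z_eq show ?thesis by (intro that[of r s]) (auto simp: w_def h_def prod_eq_iff)
qed

lemma half_in_triangle: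
  assumes "t \<in> halves"
  shows "\<exists>A\<in>\<T>. half t \<subseteq> A \<and> set (corners t) \<subseteq> A"
proof -
  obtain i j up where t: "t = (i, j, up)" by (cases t) auto
  have ij: "i < n - 1" "j < n - 1" using assms by (auto simp: t halves_def)
  let ?A = "convex hull (set (corners t))"
  have "?A \<in> cell_triangles x y d i j"
    by (auto simp: t cell_triangles_def Let_def insert_commute)
  then have "?A \<in> \<T>" using ij by (auto simp: structured_triangulation_def)
  moreover have "half t \<subseteq> ?A"
  proof
    fix z assume "z \<in> half t"
    then obtain r s where z: "z = (x i + r * (x (Suc i) - x i), y j + s * (y (Suc j) - y j))"
      "0 < r" "r < 1" "0 < s" "s < 1"
      "if d i j then (if up then r < s else s < r) else (if up then 1 < r + s else r + s < 1)"
      using half_coords assms unfolding t by metis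
    \<comment> \<open>The weights are the barycentric coordinates of \<open>z\<close> for the
      corners in the order of \<open>corners\<close>; the relation between \<open>r\<close> and
      \<open>s\<close> makes them nonnegative.\<close>
    show "z \<in> ?A"
    proof (cases "d i j"; cases up)
      assume "d i j" "up"
      then show ?thesis using z
        by (auto simp: t Let_def intro!: in_triangleI[of _ "1 - s" _ r _ "s - r"]) (simp_all add: algebra_simps)
    next
      assume "d i j" "\<not> up"
      then show ?thesis using z
        by (auto simp: t Let_def intro!: in_triangleI[of _ "1 - r" _ "r - s" _ s]) (simp_all add: algebra_simps)
    next
      assume "\<not> d i j" "up"
      then show ?thesis using z
        by (auto simp: t Let_def intro!: in_triangleI[of _ "1 - s" _ "r + s - 1" _ "1 - r"]) (simp_all add: algebra_simps)
    next
      assume "\<not> d i j" "\<not> up"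
      then show ?thesis using z
        by (auto simp: t Let_def intro!: in_triangleI[of _ "1 - r - s" _ r _ s]) (simp_all add: algebra_simps)
    qed
  qed
  moreover have "set (corners t) \<subseteq> ?A" by (rule hull_subset)
  ultimately show ?thesis by blast
qed

lemma fe_affine:
  assumes "v \<in> fe_space L \<T>" "t \<in> halves"
  obtains \<alpha> \<beta> \<gamma> where "\<And>z. z \<in> half t \<or> z \<in> set (corners t) \<Longrightarrow> v z = \<alpha> + \<beta> * fst z + \<gamma> * snd z"
proof -
  obtain A where A: "A \<in> \<T>" "half t \<subseteq> A" "set (corners t) \<subseteq> A"
    using half_in_triangle[OF assms(2)] by blast
  then obtain \<alpha> \<beta> \<gamma> where "\<forall>z\<in>A. v z = \<alpha> + \<beta> * fst z + \<gamma> * snd z"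
    using assms(1) by (force simp: fe_space_def affine_fun_on_def)
  with A show ?thesis by (intro that[of \<alpha> \<beta> \<gamma>]) auto
qed

lemma AE_half: "AE z in lebesgue_on (square L). \<exists>!t. t \<in> halves \<and> z \<in> half t"
proof (rule AE_lebesgue_onI)
  \<comment> \<open>Edges are replaced by the full lines that carry them: each is a null hyperplane,
    so finitely many extra ones do no harm.\<close>
  let ?N = "(\<Union>i\<in>{..n}. {z::real \<times> real. (1, 0) \<bullet> z = x i}) \<union> (\<Union>j\<in>{..n}. {z. (0, 1) \<bullet> z = y j})
    \<union> (\<Union>i\<in>{..n}. \<Union>j\<in>{..n}. {z. snd z = diagonal i j (fst z)})"
  have "negligible {z. snd z = diagonal i j (fst z)}" for i j
  proof -
    define k where "k = (if d i j then 1 else - 1) * ((y (Suc j) - y j) / (x (Suc i) - x i))"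
    have "{z. snd z = diagonal i j (fst z)} = {z. (- k, 1) \<bullet> z = (if d i j then y j else y (Suc j)) - k * x i}"
      unfolding diagonal_affine k_def[symmetric] by (auto simp: inner_prod_def algebra_simps)
    then show ?thesis by (simp only:) (rule negligible_hyperplane, simp add: zero_prod_def)
  qed
  then show "negligible ?N"
    by (intro negligible_Un negligible_Union) (auto intro!: negligible_hyperplane simp: zero_prod_def)
next
  fix z
  let ?N = "(\<Union>i\<in>{..n}. {z::real \<times> real. (1, 0) \<bullet> z = x i}) \<union> (\<Union>j\<in>{..n}. {z. (0, 1) \<bullet> z = y j})
    \<union> (\<Union>i\<in>{..n}. \<Union>j\<in>{..n}. {z. snd z = diagonal i j (fst z)})"
  assume z: "z \<in> square L" "z \<notin> ?N"
  have "\<exists>i<n - 1. x i < fst z \<and> fst z < x (Suc i)"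
    using z by (intro grid_locate[OF grid_x]) (auto simp: square_def inner_prod_def)
  then obtain i where i: "i < n - 1" "x i < fst z" "fst z < x (Suc i)" by blast
  have "\<exists>j<n - 1. y j < snd z \<and> snd z < y (Suc j)"
    using z by (intro grid_locate[OF grid_y]) (auto simp: square_def inner_prod_def)
  then obtain j where j: "j < n - 1" "y j < snd z" "snd z < y (Suc j)" by blast
  have ne: "snd z \<noteq> diagonal i j (fst z)" using z i j by auto
  let ?t = "(i, j, diagonal i j (fst z) < snd z)"
  show "\<exists>!t. t \<in> halves \<and> z \<in> half t"
  proof (rule ex1I[of _ ?t])
    show "?t \<in> halves \<and> z \<in> half ?t" using i j ne by (auto simp: halves_def half_def)
  next
    fix t assume t: "t \<in> halves \<and> z \<in> half t"
    obtain i' j' up where t_eq: "t = (i', j', up)" by (cases t) auto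
    have i': "i' < n - 1" "x i' < fst z" "fst z < x (Suc i')" and j': "j' < n - 1"
      using t by (auto simp: t_eq halves_def half_def)
    have "y j' < snd z" "snd z < y (Suc j')"
      using diagonal_range[of i' j' up "fst z"] t by (auto simp: t_eq half_def split: if_splits)
    then have "j' = j" using grid_interval_unique[OF grid_y] j j' by blast
    moreover have "i' = i" using grid_interval_unique[OF grid_x] i i' by blast
    ultimately show "t = ?t" using t by (auto simp: t_eq half_def split: if_splits)
  qed
qed (rule sets_square)

section \<open>Integration over the triangulation\<close>

lemma half_subset_square: "t \<in> halves \<Longrightarrow> half t \<subseteq> square L"
proof
  fix z assume t: "t \<in> halves" and z: "z \<in> half t"
  obtain i j up where t_eq: "t = (i, j, up)" by (cases t) auto
  have "x i \<in> {0..L}" "x (Suc i) \<in> {0..L}" "y j \<in> {0..L}" "y (Suc j) \<in> {0..L}"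
    using t by (auto intro!: grid_range[OF grid_x] grid_range[OF grid_y] simp: t_eq halves_def simp del: atLeastAtMost_iff)
  moreover have "y j < snd z" "snd z < y (Suc j)"
    using diagonal_range[of i j up "fst z"] t z by (auto simp: t_eq half_def split: if_splits)
  ultimately show "z \<in> square L" using z by (auto simp: t_eq half_def square_def mem_Times_iff)
qed

text \<open>The halves partition the square up to a null set, so almost everywhere on it exactly one
  indicator in the sum is 1.\<close>

lemma integral_square_halves:
  fixes f :: "real \<times> real \<Rightarrow> real"
  assumes "integrable (lebesgue_on (square L)) f"
  shows "(LINT z|lebesgue_on (square L). f z) = (\<Sum>t\<in>halves. LINT z|lebesgue_on (half t). f z)"
proof -
  have sq: "square L \<inter> space lebesgue \<in> sets lebesgue" using sets_square by simp
  have half': "half t \<inter> space lebesgue \<in> sets lebesgue" for t using sets_half by simp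
  have int: "integrable lebesgue (\<lambda>z. indicator (square L) z *\<^sub>R f z)"
    using assms integrable_restrict_space[OF sq, of f] by (simp only:)
  have int_half: "integrable lebesgue (\<lambda>z. indicator (half t) z *\<^sub>R f z)" if "t \<in> halves" for t
  proof -
    have "integrable lebesgue (\<lambda>z. indicator (half t) z *\<^sub>R (indicator (square L) z *\<^sub>R f z))"
      by (rule integrable_mult_indicator[OF sets_half int])
    moreover have "(\<lambda>z. indicator (half t) z *\<^sub>R (indicator (square L) z *\<^sub>R f z)) = (\<lambda>z. indicator (half t) z *\<^sub>R f z)"
      using half_subset_square[OF that] by (auto simp: indicator_def fun_eq_iff)
    ultimately show ?thesis by simp
  qed
  have "(LINT z|lebesgue_on (square L). f z) = (LINT z|lebesgue. indicator (square L) z *\<^sub>R f z)"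
    by (rule integral_restrict_space[OF sq])
  also have "\<dots> = (LINT z|lebesgue. (\<Sum>t\<in>halves. indicator (half t) z *\<^sub>R f z))"
  proof (rule integral_cong_AE)
    have "AE z in lebesgue. z \<in> square L \<longrightarrow> (\<exists>!t. t \<in> halves \<and> z \<in> half t)"
      using AE_half by (simp only: AE_restrict_space_iff[OF sq] space_completion space_lborel Int_UNIV_right)
    then show "AE z in lebesgue. indicator (square L) z *\<^sub>R f z = (\<Sum>t\<in>halves. indicator (half t) z *\<^sub>R f z)"
    proof eventually_elim
      case (elim z)
      show ?case
      proof (cases "z \<in> square L")
        case True
        with elim have "\<exists>!t. t \<in> halves \<and> z \<in> half t" by (rule mp)
        then obtain t where ex: "t \<in> halves \<and> z \<in> half t"
          and unique: "\<forall>t'. t' \<in> halves \<and> z \<in> half t' \<longrightarrow> t' = t"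
          by (rule ex1E)
        note t = conjunct1[OF ex] conjunct2[OF ex]
        have "indicator (half t') z *\<^sub>R f z = (if t' = t then f z else 0)" if "t' \<in> halves" for t'
        proof (cases "t' = t")
          case True
          then show ?thesis using t(2) by (simp only: indicator_simps if_True scaleR_one refl)
        next
          case False
          then have "z \<notin> half t'" using unique that by blast
          then show ?thesis using False by simp
        qed
        then have "(\<Sum>t\<in>halves. indicator (half t) z *\<^sub>R f z) = (\<Sum>t'\<in>halves. if t' = t then f z else 0)"
          by (intro sum.cong refl)
        then show ?thesis using True t(1) finite_halves by simp
      next
        case False
        then have "(\<Sum>t\<in>halves. indicator (half t) z *\<^sub>R f z) = 0"
          using half_subset_square by (intro sum.neutral) (auto simp: indicator_def)
        with False show ?thesis by simp
      qed
    qed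
  qed (use int int_half in \<open>auto intro!: borel_measurable_sum borel_measurable_integrable\<close>)
  also have "\<dots> = (\<Sum>t\<in>halves. LINT z|lebesgue. indicator (half t) z *\<^sub>R f z)"
    using int_half by (rule Bochner_Integration.integral_sum)
  also have "\<dots> = (\<Sum>t\<in>halves. LINT z|lebesgue_on (half t). f z)"
    by (intro sum.cong refl integral_restrict_space[OF half', symmetric])
  finally show ?thesis .
qed

text \<open>Vertex quadrature, exact for affine functions: the area of the triangle, which is half
  that of the cell, times the mean of the three corner values.\<close>

lemma integral_half_affine:
  assumes "(i, j, up) \<in> halves"
  shows "(LINT z|lebesgue_on (half (i, j, up)). \<alpha> + \<beta> * fst z + \<gamma> * snd z) =
    (x (Suc i) - x i) * (y (Suc j) - y j) / 6 * (\<Sum>z\<leftarrow>corners (i, j, up). \<alpha> + \<beta> * fst z + \<gamma> * snd z)"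
proof -
  define a w c h where "a = x i" and "w = x (Suc i) - x i" and "c = y j" and "h = y (Suc j) - y j"
  have wh: "0 < w" "0 < h" using assms step_pos by (auto simp: halves_def w_def h_def)
  have eqs: "x i = a" "x (Suc i) = a + w" "y j = c" "y (Suc j) = c + h"
    by (auto simp: a_def w_def c_def h_def)
  define k1 k0 where "k1 = (if d i j then 1 else - 1) * (h / w)"
    and "k0 = (if d i j then c else c + h) - k1 * a"
  have diag: "diagonal i j s = k0 + k1 * s" for s
    unfolding diagonal_affine eqs k0_def k1_def by (simp add: algebra_simps diff_divide_distrib)
  have k: "k1 * w = (if d i j then h else - h)" "k0 + k1 * a = (if d i j then c else c + h)"
    using wh by (auto simp: k1_def k0_def)
  have range: "c \<le> k0 + k1 * s \<and> k0 + k1 * s \<le> c + h" if "a < s" "s < a + w" for s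
    using diagonal_range[OF assms, of s] that by (simp add: eqs diag)
  \<comment> \<open>Over the middle of the cell the diagonal is at half height, whichever way it
    runs, so its orientation enters Simpson's rule only through the end values.\<close>
  have ends: "k0 + k1 * (a + w) = (if d i j then c + h else c)" "k0 + k1 * ((a + (a + w)) / 2) = c + h / 2"
    using k by (auto simp: algebra_simps add_divide_distrib)
  show ?thesis
  proof (cases up)
    case True
    \<comment> \<open>The terms \<open>0 * s\<close> present the horizontal side as an affine graph
      of slope 0, the form in which \<open>integral_affine_between\<close> takes it.\<close>
    let ?q = "\<lambda>s. (c + h + 0 * s - (k0 + k1 * s)) * (\<alpha> + \<beta> * s + \<gamma> * ((k0 + k1 * s + (c + h + 0 * s)) / 2))"
    have "(LINT z|lebesgue_on (half (i, j, up)). \<alpha> + \<beta> * fst z + \<gamma> * snd z) =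
       (a + w - a) / 6 * (?q a + 4 * ?q ((a + (a + w)) / 2) + ?q (a + w))"
      using integral_affine_between[where a = a and b = "a + w" and c = c and e = "c + h" and ?l0.0 = k0
        and ?l1.0 = k1 and ?r0.0 = "c + h" and ?r1.0 = 0 and \<alpha> = \<alpha> and \<beta> = \<beta> and \<gamma> = \<gamma>] range wh True
      by (simp add: half_def eqs diag)
    then show ?thesis
      unfolding ends k using True by (auto simp: eqs Let_def field_simps)
  next
    case False
    let ?q = "\<lambda>s. (k0 + k1 * s - (c + 0 * s)) * (\<alpha> + \<beta> * s + \<gamma> * ((c + 0 * s + (k0 + k1 * s)) / 2))"
    have "(LINT z|lebesgue_on (half (i, j, up)). \<alpha> + \<beta> * fst z + \<gamma> * snd z) =
       (a + w - a) / 6 * (?q a + 4 * ?q ((a + (a + w)) / 2) + ?q (a + w))"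
      using integral_affine_between[where a = a and b = "a + w" and c = c and e = "c + h" and ?l0.0 = c
        and ?l1.0 = 0 and ?r0.0 = k0 and ?r1.0 = k1 and \<alpha> = \<alpha> and \<beta> = \<beta> and \<gamma> = \<gamma>] range wh False
      by (simp add: half_def eqs diag)
    then show ?thesis
      unfolding ends k using False by (auto simp: eqs Let_def field_simps)
  qed
qed

end

section \<open>Skew-symmetry of the advection form\<close>

text \<open>Up to the factor \<open>1 / 6\<close>, this is the integral of \<open>v\<^sup>2 / 2\<close> times the tangential
  derivative of \<open>u\<close> along the edge from \<open>a\<close> to \<open>b\<close>, when both functions are affine on it.\<close>

definition edge_flux :: "(real \<times> real \<Rightarrow> real) \<Rightarrow> (real \<times> real \<Rightarrow> real) \<Rightarrow> real \<times> real \<Rightarrow> real \<times> real \<Rightarrow> real" where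
  "edge_flux u v a b = (u b - u a) * ((v a)\<^sup>2 + v a * v b + (v b)\<^sup>2)"

text \<open>Two adjacent triangles traverse their common edge in opposite directions, which is why
  its contributions cancel.\<close>

lemma edge_flux_swap: "edge_flux u v b a = - edge_flux u v a b"
  by (simp add: edge_flux_def algebra_simps power2_eq_square)

context rect_grid
begin

lemma affine_on_half_derivative:
  assumes "\<And>z. z \<in> half t \<Longrightarrow> v z = \<alpha> + \<beta> * fst z + \<gamma> * snd z" and "z \<in> half t"
  shows "(v has_derivative (\<lambda>w. \<beta> * fst w + \<gamma> * snd w)) (at z)" and "grad v z = (\<beta>, \<gamma>)"
proof -
  have "((\<lambda>z. \<alpha> + \<beta> * fst z + \<gamma> * snd z) has_derivative (\<lambda>w. \<beta> * fst w + \<gamma> * snd w)) (at z)"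
    by (auto intro!: derivative_eq_intros)
  then show *: "(v has_derivative (\<lambda>w. \<beta> * fst w + \<gamma> * snd w)) (at z)"
    by (rule has_derivative_transform_within_open[OF _ open_half assms(2)]) (rule assms(1)[symmetric])
  show "grad v z = (\<beta>, \<gamma>)"
    by (simp add: grad_def partial_def frechet_derivative_at[OF *, symmetric])
qed

text \<open>On a triangle \<open>V(u) \<bullet> \<nabla>v\<close> is the constant \<kappa>, so the
  integral is \<kappa> times that of the affine function \<open>v\<close>. Multiplied by twice the
  area, \<kappa> becomes a determinant of nodal differences, and its product with the sum of the
  corner values of \<open>v\<close> splits into edge terms. This is Green's formula for the
  divergence-free field \<open>V(u)\<close> and the function \<open>v\<^sup>2 / 2\<close>.\<close>

lemma integral_half_advection:
  assumes u: "u \<in> fe_space L \<T>" and v: "v \<in> fe_space L \<T>" and t: "t \<in> halves"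
    and corners: "corners t = [a, b, c]"
  shows "(LINT z|lebesgue_on (half t). (rot (grad u z) \<bullet> grad v z) * v z)
    = - (edge_flux u v a b + edge_flux u v b c + edge_flux u v c a) / 6"
proof -
  obtain i j up where t_eq: "t = (i, j, up)" by (cases t) auto
  obtain \<alpha> \<beta> \<gamma> where uaff: "\<And>z. z \<in> half t \<or> z \<in> set (corners t) \<Longrightarrow> u z = \<alpha> + \<beta> * fst z + \<gamma> * snd z"
    using fe_affine[OF u t] by metis
  obtain \<alpha>' \<beta>' \<gamma>' where vaff: "\<And>z. z \<in> half t \<or> z \<in> set (corners t) \<Longrightarrow> v z = \<alpha>' + \<beta>' * fst z + \<gamma>' * snd z"
    using fe_affine[OF v t] by metis
  define \<kappa> where "\<kappa> = \<beta> * \<gamma>' - \<gamma> * \<beta>'"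
  have "(rot (grad u z) \<bullet> grad v z) * v z = \<kappa> * (\<alpha>' + \<beta>' * fst z + \<gamma>' * snd z)" if "z \<in> half t" for z
    using affine_on_half_derivative(2)[of t u, OF uaff that] affine_on_half_derivative(2)[of t v, OF vaff that] vaff that
    by (simp add: rot_def \<kappa>_def inner_prod_def algebra_simps)
  then have "(LINT z|lebesgue_on (half t). (rot (grad u z) \<bullet> grad v z) * v z)
      = (LINT z|lebesgue_on (half t). \<kappa> * (\<alpha>' + \<beta>' * fst z + \<gamma>' * snd z))"
    by (intro Bochner_Integration.integral_cong) auto
  also have "\<dots> = \<kappa> * ((x (Suc i) - x i) * (y (Suc j) - y j) / 6 * (\<Sum>z\<leftarrow>corners t. \<alpha>' + \<beta>' * fst z + \<gamma>' * snd z))"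
    using integral_half_affine[of i j up] t by (simp add: t_eq)
  also have "\<dots> = - (edge_flux u v a b + edge_flux u v b c + edge_flux u v c a) / 6"
  proof -
    have uv: "u z = \<alpha> + \<beta> * fst z + \<gamma> * snd z" "v z = \<alpha>' + \<beta>' * fst z + \<gamma>' * snd z" if "z \<in> {a, b, c}" for z
      using uaff vaff that corners by auto
    \<comment> \<open>Twice the signed area of the triangle; the counterclockwise order of the
      corners makes it the positive area of the cell.\<close>
    have area: "(fst b - fst a) * (snd c - snd a) - (fst c - fst a) * (snd b - snd a)
        = (x (Suc i) - x i) * (y (Suc j) - y j)"
      using corners by (cases up; cases "d i j") (auto simp: t_eq Let_def algebra_simps)
    have det: "\<kappa> * ((x (Suc i) - x i) * (y (Suc j) - y j)) = (u b - u a) * (v c - v a) - (u c - u a) * (v b - v a)"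
      unfolding area[symmetric] \<kappa>_def by (simp add: uv algebra_simps)
    have "\<kappa> * ((x (Suc i) - x i) * (y (Suc j) - y j)) * (v a + v b + v c)
        = - (edge_flux u v a b + edge_flux u v b c + edge_flux u v c a)"
      unfolding det edge_flux_def by (simp add: algebra_simps power2_eq_square)
    then show ?thesis by (simp add: corners uv)
  qed
  finally show ?thesis .
qed

text \<open>Within a cell the two contributions of the diagonal cancel. What remains telescopes,
  over \<open>j\<close> for horizontal edges and over \<open>i\<close> for vertical ones, down to
  opposite sides of the square, where periodicity of \<open>u\<close> and \<open>v\<close> makes the
  fluxes equal.\<close>

lemma advection_skew:
  assumes u: "u \<in> fe_space_periodic L \<T>" and v: "v \<in> fe_space_periodic L \<T>"
    and int: "integrable (lebesgue_on (square L)) (\<lambda>z. (rot (grad u z) \<bullet> grad v z) * v z)"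
  shows "(LINT z|lebesgue_on (square L). (rot (grad u z) \<bullet> grad v z) * v z) = 0"
proof -
  let ?f = "\<lambda>z. (rot (grad u z) \<bullet> grad v z) * v z"
  have fe: "u \<in> fe_space L \<T>" "v \<in> fe_space L \<T>" using u v by (auto simp: fe_space_periodic_def)
  define hor where "hor i j = edge_flux u v (x i, y j) (x (Suc i), y j)" for i j
  define ver where "ver i j = edge_flux u v (x i, y j) (x i, y (Suc j))" for i j
  have cell: "(LINT z|lebesgue_on (half (i, j, False)). ?f z) + (LINT z|lebesgue_on (half (i, j, True)). ?f z)
      = ((hor i (Suc j) - hor i j) + (ver i j - ver (Suc i) j)) / 6" if "i < n - 1" "j < n - 1" for i j
  proof -
    have t: "(i, j, up) \<in> halves" for up using that by (simp add: halves_def)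
    let ?sw = "(x i, y j)" and ?se = "(x (Suc i), y j)" and ?nw = "(x i, y (Suc j))" and ?ne = "(x (Suc i), y (Suc j))"
    show ?thesis
    proof (cases "d i j")
      case True
      have "(LINT z|lebesgue_on (half (i, j, False)). ?f z)
          = - (edge_flux u v ?sw ?se + edge_flux u v ?se ?ne + edge_flux u v ?ne ?sw) / 6"
        using True by (intro integral_half_advection[OF fe t]) (simp add: Let_def)
      moreover have "(LINT z|lebesgue_on (half (i, j, True)). ?f z)
          = - (edge_flux u v ?sw ?ne + edge_flux u v ?ne ?nw + edge_flux u v ?nw ?sw) / 6"
        using True by (intro integral_half_advection[OF fe t]) (simp add: Let_def)
      ultimately show ?thesis
        using edge_flux_swap[of u v ?sw ?ne] edge_flux_swap[of u v ?nw ?ne] edge_flux_swap[of u v ?sw ?nw]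
        unfolding hor_def ver_def by argo
    next
      case False
      have "(LINT z|lebesgue_on (half (i, j, False)). ?f z)
          = - (edge_flux u v ?sw ?se + edge_flux u v ?se ?nw + edge_flux u v ?nw ?sw) / 6"
        using False by (intro integral_half_advection[OF fe t]) (simp add: Let_def)
      moreover have "(LINT z|lebesgue_on (half (i, j, True)). ?f z)
          = - (edge_flux u v ?se ?ne + edge_flux u v ?ne ?nw + edge_flux u v ?nw ?se) / 6"
        using False by (intro integral_half_advection[OF fe t]) (simp add: Let_def)
      ultimately show ?thesis
        using edge_flux_swap[of u v ?se ?nw] edge_flux_swap[of u v ?nw ?ne] edge_flux_swap[of u v ?sw ?nw]
        unfolding hor_def ver_def by argo
    qed
  qed
  have periodic: "w (0, s) = w (L, s)" "w (s, 0) = w (s, L)"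
    if "w \<in> {u, v}" "s \<in> {0..L}" for w s
    using u v that by (auto simp: fe_space_periodic_def)
  have ends: "x 0 = 0" "x (n - 1) = L" "y 0 = 0" "y (n - 1) = L"
    using grid_x grid_y by (auto simp: grid_points_def)
  \<comment> \<open>The range includes \<open>n - 1\<close>, the right end of the last horizontal
    edge.\<close>
  have wrap_y: "w (x i, y (n - 1)) = w (x i, y 0)" if "w \<in> {u, v}" "i \<le> n - 1" for w i
    unfolding ends by (rule periodic(2)[OF that(1) grid_range[OF grid_x that(2)], symmetric])
  have wrap_x: "w (x (n - 1), y j) = w (x 0, y j)" if "w \<in> {u, v}" "j \<le> n - 1" for w j
    unfolding ends by (rule periodic(1)[OF that(1) grid_range[OF grid_y that(2)], symmetric])
  have hor_wrap: "hor i (n - 1) = hor i 0" if "i < n - 1" for i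
    unfolding hor_def edge_flux_def using that
    using wrap_y[of u i] wrap_y[of u "Suc i"] wrap_y[of v i] wrap_y[of v "Suc i"] by simp
  have hor0: "(\<Sum>i<n - 1. \<Sum>j<n - 1. hor i (Suc j) - hor i j) = 0"
    using hor_wrap by (simp add: sum_lessThan_telescope del: One_nat_def)
  have ver_wrap: "ver (n - 1) j = ver 0 j" if "j < n - 1" for j
    unfolding ver_def edge_flux_def using that
    using wrap_x[of u j] wrap_x[of u "Suc j"] wrap_x[of v j] wrap_x[of v "Suc j"] by simp
  have "(\<Sum>i<n - 1. ver i j - ver (Suc i) j) = 0" if "j < n - 1" for j
    using sum_lessThan_telescope'[of "\<lambda>i. ver i j" "n - 1"] ver_wrap[OF that] by simp
  then have "(\<Sum>j<n - 1. \<Sum>i<n - 1. ver i j - ver (Suc i) j) = 0"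
    by (intro sum.neutral) simp
  then have ver0: "(\<Sum>i<n - 1. \<Sum>j<n - 1. ver i j - ver (Suc i) j) = 0"
    by (subst sum.swap)
  have "(LINT z|lebesgue_on (square L). ?f z) = (\<Sum>t\<in>halves. LINT z|lebesgue_on (half t). ?f z)"
    by (rule integral_square_halves[OF int])
  also have "\<dots> = (\<Sum>i<n - 1. \<Sum>j<n - 1. \<Sum>up\<in>UNIV. LINT z|lebesgue_on (half (i, j, up)). ?f z)"
    by (simp add: halves_def sum.cartesian_product split_def)
  also have "\<dots> = (\<Sum>i<n - 1. \<Sum>j<n - 1. ((hor i (Suc j) - hor i j) + (ver i j - ver (Suc i) j)) / 6)"
    using cell by (intro sum.cong refl) (simp add: UNIV_bool)
  also have "\<dots> = 0"
    using hor0 ver0 by (simp add: sum.distrib flip: sum_divide_distrib)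
  finally show ?thesis .
qed

section \<open>Boundedness and differentiability of finite element functions\<close>

lemma Linf_fun_halves:
  assumes aff: "\<And>t. t \<in> halves \<Longrightarrow> \<exists>\<alpha> \<beta> \<gamma>. \<forall>z\<in>half t. f z = \<alpha> + \<beta> * fst z + \<gamma> * snd z"
  shows "Linf_fun (square L) f"
proof -
  let ?T = "\<Union>t\<in>halves. half t"
  have cover: "AE z in lebesgue_on (square L). z \<in> ?T"
    using AE_half by eventually_elim blast
  \<comment> \<open>Continuity is claimed only on the union of the open triangles, since
    \<open>f\<close> may be a derivative that jumps across edges; measurability on the square
    follows because the rest is null.\<close>
  have cont: "continuous_on ?T f"
  proof (rule continuous_on_open_UN)
    fix t assume "t \<in> halves"
    then obtain \<alpha> \<beta> \<gamma> where "\<forall>z\<in>half t. f z = \<alpha> + \<beta> * fst z + \<gamma> * snd z" using aff by blast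
    then show "continuous_on (half t) f"
      by (subst continuous_on_cong[OF refl, of _ f "\<lambda>z. \<alpha> + \<beta> * fst z + \<gamma> * snd z"]) (auto intro!: continuous_intros)
  qed (rule open_half)
  have T: "?T \<in> sets lebesgue" using finite_halves sets_half by (intro sets.finite_UN) auto
  have "negligible (square L - ?T)"
  proof -
    have "AE z in lebesgue. z \<notin> square L - ?T"
      using cover sets_square by (simp add: AE_restrict_space_iff) 
    then show ?thesis using T sets_square[of L]
      by (simp add: negligible_iff_null_sets completion.null_sets_iff_AE)
  qed
  from borel_measurable_spike[OF sets_square T this continuous_imp_measurable_on_sets_lebesgue[OF cont T]]
  have meas: "f \<in> borel_measurable (lebesgue_on (square L))" .
  have "\<exists>B. \<forall>z\<in>half t. \<bar>f z\<bar> \<le> B" if t: "t \<in> halves" for t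
  proof -
    obtain \<alpha> \<beta> \<gamma> where f: "\<forall>z\<in>half t. f z = \<alpha> + \<beta> * fst z + \<gamma> * snd z" using aff t by blast
    have "\<bar>f z\<bar> \<le> \<bar>\<alpha>\<bar> + \<bar>\<beta>\<bar> * L + \<bar>\<gamma>\<bar> * L" if z: "z \<in> half t" for z
    proof -
      have "z \<in> square L" using half_subset_square[OF t] z by blast
      then have "\<bar>\<beta> * fst z\<bar> \<le> \<bar>\<beta>\<bar> * L" "\<bar>\<gamma> * snd z\<bar> \<le> \<bar>\<gamma>\<bar> * L"
        by (auto simp: square_def abs_mult intro!: mult_left_mono)
      then show ?thesis using f z by fastforce
    qed
    then show ?thesis by blast
  qed
  then obtain B where B: "\<And>t z. t \<in> halves \<Longrightarrow> z \<in> half t \<Longrightarrow> \<bar>f z\<bar> \<le> B t" by metis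
  have "AE z in lebesgue_on (square L). \<bar>f z\<bar> \<le> (\<Sum>t\<in>halves. \<bar>B t\<bar>)"
    using cover
  proof eventually_elim
    case (elim z)
    then obtain t where t: "t \<in> halves" "z \<in> half t" by blast
    have "\<bar>f z\<bar> \<le> \<bar>B t\<bar>" using B[OF t] by linarith
    also have "\<dots> \<le> (\<Sum>t\<in>halves. \<bar>B t\<bar>)" using t finite_halves by (intro member_le_sum) auto
    finally show ?case .
  qed
  with meas show ?thesis by (auto simp: Linf_fun_iff)
qed

lemma Linf_fun_fe:
  assumes v: "v \<in> fe_space L \<T>"
  shows "Linf_fun (square L) v" "Linf_fun (square L) (partial (1, 0) v)" "Linf_fun (square L) (partial (0, 1) v)"
proof -
  have *: "\<exists>\<alpha> \<beta> \<gamma>. \<forall>z\<in>half t. v z = \<alpha> + \<beta> * fst z + \<gamma> * snd z \<and> grad v z = (\<beta>, \<gamma>)" if t: "t \<in> halves" for t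
  proof -
    obtain \<alpha> \<beta> \<gamma> where vaff: "\<And>z. z \<in> half t \<or> z \<in> set (corners t) \<Longrightarrow> v z = \<alpha> + \<beta> * fst z + \<gamma> * snd z"
      using fe_affine[OF v t] by metis
    then show ?thesis using affine_on_half_derivative(2)[of t v] by blast
  qed
  then show "Linf_fun (square L) v" by (intro Linf_fun_halves) blast
  show "Linf_fun (square L) (partial (1, 0) v)"
  proof (rule Linf_fun_halves)
    fix t assume "t \<in> halves"
    from *[OF this] obtain \<beta> where "\<forall>z\<in>half t. partial (1, 0) v z = \<beta>" by (auto simp: grad_def)
    then show "\<exists>\<alpha> \<beta> \<gamma>. \<forall>z\<in>half t. partial (1, 0) v z = \<alpha> + \<beta> * fst z + \<gamma> * snd z"
      by (intro exI[of _ \<beta>] exI[of _ 0]) simp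
  qed
  show "Linf_fun (square L) (partial (0, 1) v)"
  proof (rule Linf_fun_halves)
    fix t assume "t \<in> halves"
    from *[OF this] obtain \<beta> where "\<forall>z\<in>half t. partial (0, 1) v z = \<beta>" by (auto simp: grad_def)
    then show "\<exists>\<alpha> \<beta> \<gamma>. \<forall>z\<in>half t. partial (0, 1) v z = \<alpha> + \<beta> * fst z + \<gamma> * snd z"
      by (intro exI[of _ \<beta>] exI[of _ 0]) simp
  qed
qed

lemma AE_fe_differentiable:
  assumes v: "v \<in> fe_space L \<T>"
  shows "AE z in lebesgue_on (square L). v differentiable (at z)"
  using AE_half
proof eventually_elim
  case (elim z)
  then obtain t where t: "t \<in> halves" "z \<in> half t" by blast
  obtain \<alpha> \<beta> \<gamma> where aff: "\<And>z. z \<in> half t \<or> z \<in> set (corners t) \<Longrightarrow> v z = \<alpha> + \<beta> * fst z + \<gamma> * snd z"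
    using fe_affine[OF v t(1)] by metis
  have "(v has_derivative (\<lambda>w. \<beta> * fst w + \<gamma> * snd w)) (at z)"
    by (rule affine_on_half_derivative(1)[OF _ t(2)]) (rule aff, rule disjI1)
  then show ?case by (auto simp: differentiable_def)
qed

lemma fe_space_sum:
  assumes "finite I" "\<And>i. i \<in> I \<Longrightarrow> v i \<in> fe_space L A"
  shows "(\<lambda>z. \<Sum>i\<in>I. c i * v i z) \<in> fe_space L A"
  using assms
proof (induction I rule: finite_induct)
  case empty
  have "affine_fun_on B (\<lambda>z. 0)" for B
    unfolding affine_fun_on_def by (intro exI[of _ 0]) simp
  then show ?case by (simp add: fe_space_def)
next
  case (insert j I)
  have "affine_fun_on B (\<lambda>z. c j * v j z + (\<Sum>i\<in>I. c i * v i z))" if B: "B \<in> A" for B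
  proof -
    obtain \<alpha> \<beta> \<gamma> where 1: "\<forall>z\<in>B. v j z = \<alpha> + \<beta> * fst z + \<gamma> * snd z"
      using insert.prems[of j] B by (force simp: fe_space_def affine_fun_on_def)
    obtain \<alpha>' \<beta>' \<gamma>' where 2: "\<forall>z\<in>B. (\<Sum>i\<in>I. c i * v i z) = \<alpha>' + \<beta>' * fst z + \<gamma>' * snd z"
      using insert.IH insert.prems B by (force simp: fe_space_def affine_fun_on_def)
    show ?thesis unfolding affine_fun_on_def
      using 1 2 by (intro exI[of _ "c j * \<alpha> + \<alpha>'"] exI[of _ "c j * \<beta> + \<beta>'"] exI[of _ "c j * \<gamma> + \<gamma>'"])
        (simp add: algebra_simps)
  qed
  moreover have "continuous_on (closure (square L)) (\<lambda>z. c j * v j z + (\<Sum>i\<in>I. c i * v i z))"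
    using insert by (intro continuous_intros) (auto simp: fe_space_def)
  ultimately show ?case using insert.hyps by (simp add: fe_space_def)
qed

end

section \<open>The finite element matrices\<close>

text \<open>The matrices of the scheme have integrals as entries. Moving the finite sums inside
  turns a form in the coefficients into one integral, which can then be recognised in terms of
  finite element functions.\<close>

lemma bilinear_form_integral:
  fixes g :: "'n::finite \<Rightarrow> 'n \<Rightarrow> 'b \<Rightarrow> real"
  assumes "\<And>I J. integrable M (g I J)"
  shows "a \<bullet> ((\<chi> I J. LINT z|M. g I J z) *v b)
    = (LINT z|M. (\<Sum>I\<in>UNIV. \<Sum>J\<in>UNIV. a $ I * b $ J * g I J z))"
  using assms
  by (simp add: inner_vec_def matrix_vector_mult_def sum_distrib_left mult_ac)

lemma norm_rot: "norm (rot g) = norm g"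
  by (simp add: rot_def norm_prod_def add.commute)

lemma linear_rot: "linear rot"
  by (auto intro!: linearI simp: rot_def)

lemma fe_fun_linear: "linear (\<lambda>a. fe_fun \<phi> a z)"
  by (auto intro!: linearI simp: fe_fun_def sum.distrib sum_distrib_left algebra_simps)

locale fe_discretization = rect_grid L n x y d
  for L n x y d +
  fixes \<nu> :: "'n::finite \<Rightarrow> nat \<times> nat" and \<phi> :: "'n \<Rightarrow> real \<times> real \<Rightarrow> real"
  assumes L_pos: "0 < L" and basis: "nodal_basis L \<T> n x y \<nu> \<phi>"
begin

abbreviation "\<Omega> \<equiv> lebesgue_on (square L)"
abbreviation "fe \<equiv> fe_fun \<phi>"

lemma basis_periodic: "\<phi> I \<in> fe_space_periodic L \<T>"
  using basis by (simp add: nodal_basis_def)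

lemma basis_fe: "\<phi> I \<in> fe_space L \<T>"
  using basis_periodic by (simp add: fe_space_periodic_def)

lemma fe_fun_fe: "fe a \<in> fe_space L \<T>"
  unfolding fe_fun_def by (rule fe_space_sum) (auto intro: basis_fe)

lemma fe_fun_periodic: "fe a \<in> fe_space_periodic L \<T>"
proof -
  have "\<phi> I (0, s) = \<phi> I (L, s)" "\<phi> I (s, 0) = \<phi> I (s, L)" if "s \<in> {0..L}" for I s
    using basis_periodic[of I] that by (auto simp: fe_space_periodic_def)
  then have "fe a (0, s) = fe a (L, s) \<and> fe a (s, 0) = fe a (s, L)" if "s \<in> {0..L}" for s
    using that unfolding fe_fun_def by auto
  then show ?thesis using fe_fun_fe by (auto simp: fe_space_periodic_def)
qed

lemma fe_fun_node: "fe a (x (fst (\<nu> J)), y (snd (\<nu> J))) = a $ J"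
  using basis by (simp add: nodal_basis_def fe_fun_def if_distrib[of "\<lambda>r. _ * r"] cong: if_cong)

lemma Linf_fe:
  "Linf_fun (square L) (fe a)" "Linf_fun (square L) (partial (1, 0) (fe a))" "Linf_fun (square L) (partial (0, 1) (fe a))"
  "Linf_fun (square L) (\<phi> I)" "Linf_fun (square L) (partial (1, 0) (\<phi> I))" "Linf_fun (square L) (partial (0, 1) (\<phi> I))"
  using Linf_fun_fe[OF fe_fun_fe] Linf_fun_fe[OF basis_fe] by auto

lemma integrable_Linf: "Linf_fun (square L) f \<Longrightarrow> integrable \<Omega> f"
  by (rule Linf_fun_integrable[OF lmeasurable_square])

lemma L2_Linf: "Linf_fun (square L) f \<Longrightarrow> L2_fun (square L) f"
  by (rule Linf_fun_imp_L2_fun[OF lmeasurable_square])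

lemma Linf_fun_inner:
  assumes "Linf_fun (square L) (\<lambda>z. fst (f z))" "Linf_fun (square L) (\<lambda>z. snd (f z))"
    and "Linf_fun (square L) (\<lambda>z. fst (g z))" "Linf_fun (square L) (\<lambda>z. snd (g z))"
  shows "Linf_fun (square L) (\<lambda>z. f z \<bullet> g z)"
  unfolding inner_prod_def inner_real_def using assms by (intro Linf_intros)

lemma Linf_fun_rot:
  "Linf_fun (square L) (\<lambda>z. snd (f z)) \<Longrightarrow> Linf_fun (square L) (\<lambda>z. fst (rot (f z)))"
  "Linf_fun (square L) (\<lambda>z. fst (f z)) \<Longrightarrow> Linf_fun (square L) (\<lambda>z. snd (rot (f z)))"
  by (simp_all add: rot_def Linf_fun_minus)

lemma Linf_grad:
  "Linf_fun (square L) (\<lambda>z. fst (grad (fe a) z))" "Linf_fun (square L) (\<lambda>z. snd (grad (fe a) z))"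
  "Linf_fun (square L) (\<lambda>z. fst (grad (\<phi> I) z))" "Linf_fun (square L) (\<lambda>z. snd (grad (\<phi> I) z))"
  using Linf_fe by (auto simp: grad_def)

text \<open>One null set serves all coefficient vectors: off it each of the finitely many basis
  functions is differentiable, and then the gradient is linear in the coefficients. At a point of
  non-differentiability \<open>frechet_derivative\<close> is an arbitrary choice, for which
  linearity may fail.\<close>

lemma AE_grad_fe:
  "AE z in \<Omega>. \<forall>a. grad (fe a) z = (\<Sum>I\<in>UNIV. a $ I *\<^sub>R grad (\<phi> I) z)"
proof -
  have "AE z in \<Omega>. \<forall>I\<in>UNIV. \<phi> I differentiable (at z)"
    by (rule AE_finite_allI) (auto intro: AE_fe_differentiable basis_fe)
  then show ?thesis
  proof eventually_elim
    case (elim z)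
    have "partial e (fe a) z = (\<Sum>I\<in>UNIV. a $ I * partial e (\<phi> I) z)" for a e
    proof -
      have "((\<lambda>z. \<Sum>I\<in>UNIV. a $ I * \<phi> I z) has_derivative
          (\<lambda>e. \<Sum>I\<in>UNIV. a $ I * frechet_derivative (\<phi> I) (at z) e)) (at z)"
        using elim by (intro has_derivative_sum has_derivative_mult_right) (simp add: frechet_derivative_works)
      then have "(fe a has_derivative (\<lambda>e. \<Sum>I\<in>UNIV. a $ I * frechet_derivative (\<phi> I) (at z) e)) (at z)"
        by (simp add: fe_fun_def[abs_def])
      from fun_cong[OF frechet_derivative_at[OF this], of e] show ?thesis by (simp add: partial_def)
    qed
    then show ?case by (simp add: grad_def prod_eq_iff fst_sum snd_sum)
  qed
qed

section \<open>The matrices as forms on the finite element space\<close>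

lemma inner_mass: "a \<bullet> (mass_matrix L \<phi> *v b) = L2_inner (square L) (fe a) (fe b)"
proof -
  have "a \<bullet> (mass_matrix L \<phi> *v b) = (LINT z|\<Omega>. (\<Sum>I\<in>UNIV. \<Sum>J\<in>UNIV. a $ I * b $ J * (\<phi> I z * \<phi> J z)))"
    unfolding mass_matrix_def L2_inner_def
    by (rule bilinear_form_integral) (intro integrable_Linf Linf_intros Linf_fe)
  also have "\<dots> = L2_inner (square L) (fe a) (fe b)"
    unfolding L2_inner_def fe_fun_def by (simp add: sum_product mult_ac)
  finally show ?thesis .
qed

lemma M_norm_eq: "M_norm L \<phi> a = L2_norm (square L) (fe a)"
  by (simp add: M_norm_def L2_norm_def inner_mass)

lemma inner_K:
  "a \<bullet> (K_matrix L \<phi> *v b) = L2_inner (square L) (fe a) (fe b) + (LINT z|\<Omega>. grad (fe a) z \<bullet> grad (fe b) z)"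
proof -
  have "K_matrix L \<phi> = mass_matrix L \<phi> + (\<chi> I J. LINT z|\<Omega>. grad (\<phi> I) z \<bullet> grad (\<phi> J) z)"
    by (simp add: K_matrix_def mass_matrix_def H1_inner_def vec_eq_iff)
  moreover have "a \<bullet> ((\<chi> I J. LINT z|\<Omega>. grad (\<phi> I) z \<bullet> grad (\<phi> J) z) *v b)
      = (LINT z|\<Omega>. (\<Sum>I\<in>UNIV. \<Sum>J\<in>UNIV. a $ I * b $ J * (grad (\<phi> I) z \<bullet> grad (\<phi> J) z)))"
    by (rule bilinear_form_integral) (intro integrable_Linf Linf_fun_inner Linf_fun_rot Linf_grad)
  moreover have "\<dots> = (LINT z|\<Omega>. grad (fe a) z \<bullet> grad (fe b) z)"
  proof (rule integral_cong_AE)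
    show "AE z in \<Omega>. (\<Sum>I\<in>UNIV. \<Sum>J\<in>UNIV. a $ I * b $ J * (grad (\<phi> I) z \<bullet> grad (\<phi> J) z)) = grad (fe a) z \<bullet> grad (fe b) z"
      using AE_grad_fe
    proof eventually_elim
      case (elim z)
      have "grad (fe a) z \<bullet> grad (fe b) z = (\<Sum>I\<in>UNIV. (a $ I *\<^sub>R grad (\<phi> I) z) \<bullet> grad (fe b) z)"
        by (subst elim[rule_format, of a]) (rule inner_sum_left)
      then show ?case
        by (simp add: elim[rule_format, of b] inner_sum_right sum_distrib_left mult_ac)
    qed
  qed (auto intro!: Linf_fun_measurable Linf_intros Linf_fun_inner Linf_fun_rot Linf_grad)
  ultimately show ?thesis by (simp add: matrix_vector_mult_add_rdistrib inner_add_right inner_mass)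
qed

lemma inner_R:
  assumes p: "Linf_fun (square L) (weak_partial (square L) (1, 0) p)" "Linf_fun (square L) (weak_partial (square L) (0, 1) p)"
  shows "b \<bullet> (R_matrix L \<phi> p *v a)
    = L2_inner (square L) (\<lambda>z. rot (weak_grad (square L) p z) \<bullet> grad (fe a) z) (fe b)"
proof -
  let ?G = "weak_grad (square L) p"
  have G: "Linf_fun (square L) (\<lambda>z. fst (?G z))" "Linf_fun (square L) (\<lambda>z. snd (?G z))"
    using p by (auto simp: weak_grad_def)
  have "b \<bullet> (R_matrix L \<phi> p *v a)
      = (LINT z|\<Omega>. (\<Sum>I\<in>UNIV. \<Sum>J\<in>UNIV. b $ I * a $ J * ((rot (?G z) \<bullet> grad (\<phi> J) z) * \<phi> I z)))"
    unfolding R_matrix_def L2_inner_def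
    by (rule bilinear_form_integral) (intro integrable_Linf Linf_intros Linf_fun_inner Linf_fun_rot Linf_grad Linf_fe G)
  also have "\<dots> = (LINT z|\<Omega>. (rot (?G z) \<bullet> grad (fe a) z) * fe b z)"
  proof (rule integral_cong_AE)
    show "AE z in \<Omega>. (\<Sum>I\<in>UNIV. \<Sum>J\<in>UNIV. b $ I * a $ J * ((rot (?G z) \<bullet> grad (\<phi> J) z) * \<phi> I z))
        = (rot (?G z) \<bullet> grad (fe a) z) * fe b z"
      using AE_grad_fe
    proof eventually_elim
      case (elim z)
      have "(rot (?G z) \<bullet> grad (fe a) z) * fe b z
          = (\<Sum>J\<in>UNIV. \<Sum>I\<in>UNIV. (a $ J * (rot (?G z) \<bullet> grad (\<phi> J) z)) * (b $ I * \<phi> I z))"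
        by (simp add: elim fe_fun_def inner_sum_right sum_product)
      also have "\<dots> = (\<Sum>I\<in>UNIV. \<Sum>J\<in>UNIV. (a $ J * (rot (?G z) \<bullet> grad (\<phi> J) z)) * (b $ I * \<phi> I z))"
        by (rule sum.swap)
      finally show ?case by (simp add: mult_ac)
    qed
  qed (auto intro!: Linf_fun_measurable Linf_intros Linf_fun_inner Linf_fun_rot Linf_grad Linf_fe G)
  finally show ?thesis by (simp add: L2_inner_def)
qed

lemma inner_S:
  "c \<bullet> (S_matrix L \<phi> a *v b) = - L2_inner (square L) (\<lambda>z. rot (grad (fe a) z) \<bullet> grad (fe c) z) (fe b)"
proof -
  let ?G = "grad (fe a)"
  have "c \<bullet> (S_matrix L \<phi> a *v b)
      = (LINT z|\<Omega>. (\<Sum>I\<in>UNIV. \<Sum>J\<in>UNIV. c $ I * b $ J * - ((rot (?G z) \<bullet> grad (\<phi> I) z) * \<phi> J z)))"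
    unfolding S_matrix_def L2_inner_def Bochner_Integration.integral_minus[symmetric]
    by (rule bilinear_form_integral) (intro integrable_Linf Linf_intros Linf_fun_inner Linf_fun_rot Linf_grad Linf_fe)
  also have "\<dots> = (LINT z|\<Omega>. - ((rot (?G z) \<bullet> grad (fe c) z) * fe b z))"
  proof (rule integral_cong_AE)
    show "AE z in \<Omega>. (\<Sum>I\<in>UNIV. \<Sum>J\<in>UNIV. c $ I * b $ J * - ((rot (?G z) \<bullet> grad (\<phi> I) z) * \<phi> J z))
        = - ((rot (?G z) \<bullet> grad (fe c) z) * fe b z)"
      using AE_grad_fe
    proof eventually_elim
      case (elim z)
      have "(rot (?G z) \<bullet> grad (fe c) z) * fe b z
          = (\<Sum>I\<in>UNIV. \<Sum>J\<in>UNIV. (c $ I * (rot (?G z) \<bullet> grad (\<phi> I) z)) * (b $ J * \<phi> J z))"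
        by (subst elim[rule_format, of c]) (simp add: fe_fun_def inner_sum_right sum_product)
      then show ?case by (simp add: mult_ac sum_negf)
    qed
  qed (auto intro!: Linf_fun_measurable Linf_intros Linf_fun_inner Linf_fun_rot Linf_grad Linf_fe)
  finally show ?thesis by (simp add: L2_inner_def)
qed

lemma S_linear: "linear (S_matrix L \<phi>)"
proof (rule linearI)
  have int: "integrable \<Omega> (\<lambda>z. (rot (grad (fe a) z) \<bullet> grad (\<phi> I) z) * \<phi> J z)" for a I J
    by (intro integrable_Linf Linf_intros Linf_fun_inner Linf_fun_rot Linf_grad Linf_fe)
  fix a b :: "real^'n" and r :: real
  have "(LINT z|\<Omega>. (rot (grad (fe (a + b)) z) \<bullet> grad (\<phi> I) z) * \<phi> J z)
      = (LINT z|\<Omega>. (rot (grad (fe a) z) \<bullet> grad (\<phi> I) z) * \<phi> J z + (rot (grad (fe b) z) \<bullet> grad (\<phi> I) z) * \<phi> J z)" for I J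
  proof (rule integral_cong_AE)
    show "AE z in \<Omega>. (rot (grad (fe (a + b)) z) \<bullet> grad (\<phi> I) z) * \<phi> J z
        = (rot (grad (fe a) z) \<bullet> grad (\<phi> I) z) * \<phi> J z + (rot (grad (fe b) z) \<bullet> grad (\<phi> I) z) * \<phi> J z"
      using AE_grad_fe
      by eventually_elim (simp add: scaleR_left_distrib sum.distrib linear_add[OF linear_rot] inner_add_left algebra_simps)
  qed (use int in \<open>auto intro!: borel_measurable_integrable\<close>)
  then show "S_matrix L \<phi> (a + b) = S_matrix L \<phi> a + S_matrix L \<phi> b"
    using int by (simp add: S_matrix_def L2_inner_def vec_eq_iff)
  have "(LINT z|\<Omega>. (rot (grad (fe (r *\<^sub>R a)) z) \<bullet> grad (\<phi> I) z) * \<phi> J z)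
      = (LINT z|\<Omega>. r * ((rot (grad (fe a) z) \<bullet> grad (\<phi> I) z) * \<phi> J z))" for I J
  proof (rule integral_cong_AE)
    show "AE z in \<Omega>. (rot (grad (fe (r *\<^sub>R a)) z) \<bullet> grad (\<phi> I) z) * \<phi> J z
        = r * ((rot (grad (fe a) z) \<bullet> grad (\<phi> I) z) * \<phi> J z)"
      using AE_grad_fe
    proof eventually_elim
      case (elim z)
      have "grad (fe (r *\<^sub>R a)) z = r *\<^sub>R grad (fe a) z"
        by (simp add: elim scaleR_sum_right)
      then show ?case by (simp add: linear_scale[OF linear_rot])
    qed
  qed (use int in \<open>auto intro!: borel_measurable_integrable borel_measurable_times\<close>)
  then show "S_matrix L \<phi> (r *\<^sub>R a) = r *\<^sub>R S_matrix L \<phi> a"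
    by (simp add: S_matrix_def L2_inner_def vec_eq_iff)
qed

lemma S_skew: "b \<bullet> (S_matrix L \<phi> a *v b) = 0"
proof -
  have "integrable \<Omega> (\<lambda>z. (rot (grad (fe a) z) \<bullet> grad (fe b) z) * fe b z)"
    by (intro integrable_Linf Linf_intros Linf_fun_inner Linf_fun_rot Linf_grad Linf_fe)
  from advection_skew[OF fe_fun_periodic fe_fun_periodic this] show ?thesis
    by (simp add: inner_S L2_inner_def)
qed

section \<open>Bounds and positivity of the forms\<close>

lemma L2_norm_mono_AE:
  assumes "Linf_fun (square L) f" "Linf_fun (square L) g" "AE z in \<Omega>. (f z)\<^sup>2 \<le> g z"
  shows "L2_norm (square L) f \<le> sqrt (LINT z|\<Omega>. g z)"
  unfolding L2_norm_def L2_inner_def real_sqrt_le_iff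
  using assms by (intro integral_mono_AE integrable_Linf Linf_intros) (auto simp: power2_eq_square)

text \<open>Hoelder's inequality with exponents 4, 4 and 2. Cauchy-Schwarz in L2 splits off
  \<open>fe b\<close>; the pointwise inequality and a second use in L2 separate the two gradients.
  The rotation does not change lengths.\<close>

lemma S_bound:
  "\<bar>c \<bullet> (S_matrix L \<phi> a *v b)\<bar>
    \<le> W14_seminorm (square L) (fe a) * W14_seminorm (square L) (fe c) * L2_norm (square L) (fe b)"
proof -
  let ?f = "\<lambda>z. rot (grad (fe a) z) \<bullet> grad (fe c) z"
  let ?s = "\<lambda>a z. (norm (grad (fe a) z))\<^sup>2"
  have s: "Linf_fun (square L) (?s a)" for a
    unfolding power2_norm_eq_inner by (intro Linf_fun_inner Linf_fun_rot Linf_grad)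
  have f: "Linf_fun (square L) ?f" by (intro Linf_fun_inner Linf_fun_rot Linf_grad)
  have "(?f z)\<^sup>2 \<le> ?s a z * ?s c z" for z
  proof -
    have "\<bar>?f z\<bar> \<le> norm (grad (fe a) z) * norm (grad (fe c) z)"
      using Cauchy_Schwarz_ineq2[of "rot (grad (fe a) z)" "grad (fe c) z"] by (simp add: norm_rot)
    then have "\<bar>?f z\<bar>\<^sup>2 \<le> (norm (grad (fe a) z) * norm (grad (fe c) z))\<^sup>2" by (rule power_mono) simp
    then show ?thesis by (simp add: power_mult_distrib)
  qed
  then have "L2_norm (square L) ?f \<le> sqrt (LINT z|\<Omega>. ?s a z * ?s c z)"
    by (intro L2_norm_mono_AE Linf_fun_mult s f) simp
  also have "\<dots> \<le> sqrt (L2_norm (square L) (?s a) * L2_norm (square L) (?s c))"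
    using L2_inner_Cauchy_Schwarz[OF L2_Linf[OF s] L2_Linf[OF s], of a c]
    by (simp add: L2_inner_def)
  also have "\<dots> = W14_seminorm (square L) (fe a) * W14_seminorm (square L) (fe c)"
  proof -
    \<comment> \<open>The fourth root is taken as two successive square roots.\<close>
    have "sqrt (L2_norm (square L) (?s a)) = W14_seminorm (square L) (fe a)" for a
    proof -
      have "0 \<le> (LINT z|\<Omega>. norm (grad (fe a) z) ^ 4)" by simp
      then show ?thesis
        by (simp add: L2_norm_def L2_inner_def W14_seminorm_def powr_half_sqrt[symmetric] powr_powr flip: power_add)
    qed
    then show ?thesis by (simp add: real_sqrt_mult)
  qed
  finally have "L2_norm (square L) ?f \<le> W14_seminorm (square L) (fe a) * W14_seminorm (square L) (fe c)" .
  then have "L2_norm (square L) ?f * L2_norm (square L) (fe b)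
      \<le> W14_seminorm (square L) (fe a) * W14_seminorm (square L) (fe c) * L2_norm (square L) (fe b)"
    by (rule mult_right_mono) (rule L2_norm_nonneg)
  moreover have "\<bar>c \<bullet> (S_matrix L \<phi> a *v b)\<bar> \<le> L2_norm (square L) ?f * L2_norm (square L) (fe b)"
    using L2_inner_Cauchy_Schwarz[OF L2_Linf[OF f] L2_Linf[OF Linf_fe(1)], of b] by (simp add: inner_S)
  ultimately show ?thesis by linarith
qed

text \<open>If the form vanishes, \<open>fe a\<close> is zero almost everywhere, hence everywhere by
  continuity, since a nonempty open set is not null. The coefficients are nodal values of
  \<open>fe a\<close> and vanish with it.\<close>

lemma M_pos:
  assumes "a \<noteq> 0" shows "0 < a \<bullet> (mass_matrix L \<phi> *v a)"
proof (rule ccontr)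
  assume "\<not> 0 < a \<bullet> (mass_matrix L \<phi> *v a)"
  moreover have "0 \<le> (LINT z|\<Omega>. fe a z * fe a z)" by simp
  ultimately have "(LINT z|\<Omega>. fe a z * fe a z) = 0" by (simp add: inner_mass L2_inner_def)
  moreover have "integrable \<Omega> (\<lambda>z. fe a z * fe a z)"
    by (intro integrable_Linf Linf_intros Linf_fe)
  ultimately have "AE z in \<Omega>. fe a z * fe a z = 0"
    by (subst (asm) integral_nonneg_eq_0_iff_AE) auto
  then have AE: "AE z in lebesgue. z \<in> square L \<longrightarrow> fe a z = 0"
    using sets_square by (simp add: AE_restrict_space_iff)
  have cont: "continuous_on (closure (square L)) (fe a)" using fe_fun_fe by (simp add: fe_space_def)
  let ?V = "{z \<in> square L. fe a z \<noteq> 0}"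
  have "open ?V"
  proof -
    have "open (square L \<inter> fe a -` (- {0}))"
      by (rule continuous_open_preimage[OF continuous_on_subset[OF cont closure_subset] open_square]) auto
    moreover have "square L \<inter> fe a -` (- {0}) = ?V" by auto
    ultimately show ?thesis by simp
  qed
  moreover have "negligible ?V"
  proof -
    have "AE z in lebesgue. z \<notin> ?V" using AE by (auto elim: eventually_mono)
    moreover have "?V \<in> sets lebesgue" using \<open>open ?V\<close> by auto
    ultimately show ?thesis by (simp add: negligible_iff_null_sets completion.null_sets_iff_AE)
  qed
  ultimately have "?V = {}" using open_not_negligible by blast
  \<comment> \<open>Nodes with an index 0 lie on the boundary, so the zero set has to reach the
    closure of the square.\<close>
  then have zero: "fe a z = 0" if "z \<in> closure (square L)" for z
    using continuous_constant_on_closure[OF cont _ that, of 0] by blast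
  have "a $ J = 0" for J
  proof -
    have "\<nu> J \<in> {..<n - 1} \<times> {..<n - 1}" using basis by (auto simp: nodal_basis_def bij_betw_def)
    then have "x (fst (\<nu> J)) \<in> {0..L}" "y (snd (\<nu> J)) \<in> {0..L}"
      by (auto intro!: grid_range[OF grid_x] grid_range[OF grid_y] simp: mem_Times_iff simp del: atLeastAtMost_iff)
    then have "(x (fst (\<nu> J)), y (snd (\<nu> J))) \<in> closure (square L)"
      using L_pos by (simp add: square_def closure_Times)
    from zero[OF this] show ?thesis by (simp add: fe_fun_node)
  qed
  then show False using assms by (simp add: vec_eq_iff)
qed

lemma R_bound:
  assumes p: "Linf_fun (square L) (weak_partial (square L) (1, 0) p)" "Linf_fun (square L) (weak_partial (square L) (0, 1) p)"
    and P: "0 \<le> P" "AE z in \<Omega>. \<bar>weak_partial (square L) (1, 0) p z\<bar> \<le> P"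
      "AE z in \<Omega>. \<bar>weak_partial (square L) (0, 1) p z\<bar> \<le> P"
  shows "\<bar>b \<bullet> (R_matrix L \<phi> p *v a)\<bar> \<le> 2 * P * sqrt (a \<bullet> (K_matrix L \<phi> *v a)) * M_norm L \<phi> b"
proof -
  let ?G = "weak_grad (square L) p"
  let ?f = "\<lambda>z. rot (?G z) \<bullet> grad (fe a) z"
  have f: "Linf_fun (square L) ?f"
    using p by (intro Linf_fun_inner Linf_fun_rot Linf_grad) (auto simp: weak_grad_def)
  have "AE z in \<Omega>. (?f z)\<^sup>2 \<le> (2 * P)\<^sup>2 * (grad (fe a) z \<bullet> grad (fe a) z)"
    using P(2,3)
  proof eventually_elim
    case (elim z)
    \<comment> \<open>The source of the factor 2: the length of \<open>\<nabla>p\<close> is at most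
      the sum of the absolute values of its components, each at most \<open>P\<close>.\<close>
    have "norm (rot (?G z)) \<le> 2 * P"
      using norm_Pair_le[of "fst (?G z)" "snd (?G z)"] elim by (simp add: norm_rot weak_grad_def)
    then have "norm (rot (?G z)) * norm (grad (fe a) z) \<le> 2 * P * norm (grad (fe a) z)"
      by (rule mult_right_mono) simp
    then have "\<bar>?f z\<bar> \<le> 2 * P * norm (grad (fe a) z)"
      using Cauchy_Schwarz_ineq2[of "rot (?G z)" "grad (fe a) z"] by linarith
    then have "\<bar>?f z\<bar>\<^sup>2 \<le> (2 * P * norm (grad (fe a) z))\<^sup>2" by (rule power_mono) simp
    then show ?case by (simp add: power_mult_distrib power2_norm_eq_inner)
  qed
  then have "L2_norm (square L) ?f \<le> sqrt (LINT z|\<Omega>. (2 * P)\<^sup>2 * (grad (fe a) z \<bullet> grad (fe a) z))"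
    by (intro L2_norm_mono_AE f Linf_intros Linf_fun_inner Linf_fun_rot Linf_grad)
  also have "\<dots> = 2 * P * sqrt (LINT z|\<Omega>. grad (fe a) z \<bullet> grad (fe a) z)"
    using P(1) by (simp add: real_sqrt_mult)
  also have "\<dots> \<le> 2 * P * sqrt (a \<bullet> (K_matrix L \<phi> *v a))"
    using P(1) by (intro mult_left_mono) (auto simp: inner_K L2_inner_def)
  finally have "L2_norm (square L) ?f * L2_norm (square L) (fe b) \<le> 2 * P * sqrt (a \<bullet> (K_matrix L \<phi> *v a)) * L2_norm (square L) (fe b)"
    by (rule mult_right_mono) (rule L2_norm_nonneg)
  moreover have "\<bar>b \<bullet> (R_matrix L \<phi> p *v a)\<bar> \<le> L2_norm (square L) ?f * L2_norm (square L) (fe b)"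
    using L2_inner_Cauchy_Schwarz[OF L2_Linf[OF f] L2_Linf[OF Linf_fe(1)], of b] by (simp add: inner_R[OF p])
  ultimately show ?thesis unfolding M_norm_eq by linarith
qed

text \<open>Testing the orthogonality relation with the projection itself equates its squared norm
  with its inner product with \<open>f\<close>; Cauchy-Schwarz does the rest.\<close>

lemma L2_projection_norm_le:
  assumes f: "L2_fun (square L) f" and proj: "is_L2_projection L \<T> f (fe a)"
  shows "L2_norm (square L) (fe a) \<le> L2_norm (square L) f"
proof -
  have "0 = (LINT z|\<Omega>. (fe a z - f z) * fe a z)"
    using proj fe_fun_periodic by (simp add: is_L2_projection_def L2_inner_def)
  also have "\<dots> = (LINT z|\<Omega>. fe a z * fe a z - f z * fe a z)"
    by (simp add: left_diff_distrib)
  also have "\<dots> = (L2_norm (square L) (fe a))\<^sup>2 - L2_inner (square L) f (fe a)"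
    using L2_fun_mult_integrable[OF f L2_Linf[OF Linf_fe(1)]]
      L2_fun_mult_integrable[OF L2_Linf[OF Linf_fe(1)] L2_Linf[OF Linf_fe(1)]]
    by (simp add: L2_norm_sq) (simp add: L2_inner_def)
  finally have "L2_norm (square L) (fe a) * L2_norm (square L) (fe a) \<le> L2_norm (square L) (fe a) * L2_norm (square L) f"
    using L2_inner_Cauchy_Schwarz[OF f L2_Linf[OF Linf_fe(1)], of a] by (simp add: power2_eq_square mult.commute)
  then show ?thesis
    using L2_norm_nonneg[of "square L" "fe a"] L2_norm_nonneg[of "square L" f]
    by (cases "L2_norm (square L) (fe a) = 0") (auto simp: mult_le_cancel_left)
qed

lemma mesh_size_nonneg: "0 \<le> mesh_size \<T>"
proof -
  \<comment> \<open>With two grid points per direction there is at least one triangle, whose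
    diameter is nonnegative and below the maximum.\<close>
  have "2 \<le> n" using grid_x by (simp add: grid_points_def)
  then have "(0, 0, False) \<in> halves" by (simp add: halves_def)
  then obtain A where A: "A \<in> \<T>" using half_in_triangle by blast
  have "finite (cell_triangles x y d i j)" for i j by (simp add: cell_triangles_def Let_def)
  then have fin: "finite \<T>" by (simp add: structured_triangulation_def)
  have "bounded A" using A
    by (auto simp: structured_triangulation_def cell_triangles_def Let_def finite_imp_bounded_convex_hull split: if_splits)
  then have "0 \<le> diameter A" by (rule diameter_ge_0)
  also have "\<dots> \<le> mesh_size \<T>" unfolding mesh_size_def using A fin by (intro Max_ge) auto
  finally show ?thesis .
qed

end

section \<open>Instantiation of the algebraic setting\<close>

context fe_discretization
begin

text \<open>The square has positive measure. An almost everywhere bound therefore holds at some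
  point, which forces the norm of \<open>p\<close> to be nonnegative.\<close>

lemma not_AE_False: "\<not> (AE z in \<Omega>. False)"
proof
  assume "AE z in \<Omega>. False"
  then have "AE z in lebesgue. z \<notin> square L"
    using sets_square by (simp add: AE_restrict_space_iff)
  then have "negligible (square L)"
    using sets_square by (simp add: negligible_iff_null_sets completion.null_sets_iff_AE)
  moreover have "(L / 2, L / 2) \<in> square L" using L_pos by (simp add: square_def)
  ultimately show False using open_not_negligible[OF open_square] by blast
qed

lemma W1inf_norm_bounds:
  assumes "W1inf_fun (square L) p"
  shows "0 \<le> W1inf_norm (square L) p"
    and "AE z in \<Omega>. \<bar>weak_partial (square L) (1, 0) p z\<bar> \<le> W1inf_norm (square L) p"
    and "AE z in \<Omega>. \<bar>weak_partial (square L) (0, 1) p z\<bar> \<le> W1inf_norm (square L) p"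
proof -
  define m where "m = max (Linf_norm (square L) p) (max (Linf_norm (square L) (weak_partial (square L) (1, 0) p))
    (Linf_norm (square L) (weak_partial (square L) (0, 1) p)))"
  have m_fin: "m < \<infinity>"
    unfolding m_def max_less_iff_conj
    using assms by (auto simp: W1inf_fun_def Linf_fun_def Basis_prod_def)
  have bound: "AE z in \<Omega>. \<bar>f z\<bar> \<le> real_of_ereal m" if "Linf_norm (square L) f \<le> m" for f
  proof -
    have "AE z in \<Omega>. ereal \<bar>f z\<bar> \<le> Linf_norm (square L) f"
      unfolding Linf_norm_def by (rule esssup_AE)
    then show ?thesis
    proof eventually_elim
      case (elim z)
      then have "ereal \<bar>f z\<bar> \<le> m" using that by (rule order_trans)
      then show ?case using m_fin by (cases m) auto
    qed
  qed
  have m: "W1inf_norm (square L) p = real_of_ereal m" by (simp add: W1inf_norm_def m_def)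
  show 1: "AE z in \<Omega>. \<bar>weak_partial (square L) (1, 0) p z\<bar> \<le> W1inf_norm (square L) p"
    and "AE z in \<Omega>. \<bar>weak_partial (square L) (0, 1) p z\<bar> \<le> W1inf_norm (square L) p"
    unfolding m by (rule bound, simp add: m_def le_max_iff_disj)+
  show "0 \<le> W1inf_norm (square L) p"
  proof (rule ccontr)
    assume "\<not> 0 \<le> W1inf_norm (square L) p"
    with 1 have "AE z in \<Omega>. False" by (auto elim: eventually_mono)
    then show False using not_AE_False by blast
  qed
qed

text \<open>Two of the three factors in the bound for \<open>S\<close> are
  \<open>W14_seminorm\<close> values, and each costs one inverse estimate; the third is already an
  L2 norm. Hence the constant \<open>c\<^sup>2\<close>.\<close>

lemma fe_discrete_scheme:
  assumes p: "W1inf_fun (square L) p"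
    and c_inv: "\<And>v. v \<in> fe_space L \<T> \<Longrightarrow> W14_seminorm (square L) v \<le> c * L2_norm (square L) v"
  shows "discrete_scheme L \<phi> p (W1inf_norm (square L) p) (c\<^sup>2)"
proof (rule discrete_scheme.intro)
  fix a b e :: "real^'n"
  have p_Linf: "Linf_fun (square L) (weak_partial (square L) (1, 0) p)" "Linf_fun (square L) (weak_partial (square L) (0, 1) p)"
    using p by (auto simp: W1inf_fun_def Basis_prod_def)
  show "a \<bullet> (mass_matrix L \<phi> *v b) = b \<bullet> (mass_matrix L \<phi> *v a)"
    by (simp add: inner_mass L2_inner_def mult.commute)
  show "0 < a \<bullet> (mass_matrix L \<phi> *v a)" if "a \<noteq> 0" using that by (rule M_pos)
  show "a \<bullet> (mass_matrix L \<phi> *v a) \<le> a \<bullet> (K_matrix L \<phi> *v a)" by (simp add: inner_mass inner_K)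
  show "linear (S_matrix L \<phi>)" by (rule S_linear)
  show "b \<bullet> (S_matrix L \<phi> a *v b) = 0" by (rule S_skew)
  show "0 \<le> c\<^sup>2" by simp
  show "0 \<le> W1inf_norm (square L) p" using p by (rule W1inf_norm_bounds)
  show "\<bar>b \<bullet> (R_matrix L \<phi> p *v a)\<bar> \<le> 2 * W1inf_norm (square L) p * sqrt (a \<bullet> (K_matrix L \<phi> *v a)) * M_norm L \<phi> b"
    by (rule R_bound[OF p_Linf W1inf_norm_bounds[OF p]])
  have W14: "0 \<le> W14_seminorm (square L) (fe a)" "W14_seminorm (square L) (fe a) \<le> c * M_norm L \<phi> a" for a
    using c_inv[OF fe_fun_fe] by (auto simp: W14_seminorm_def M_norm_eq)
  have "\<bar>e \<bullet> (S_matrix L \<phi> a *v b)\<bar>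
      \<le> W14_seminorm (square L) (fe a) * W14_seminorm (square L) (fe e) * M_norm L \<phi> b"
    using S_bound unfolding M_norm_eq .
  also have "\<dots> \<le> (c * M_norm L \<phi> a) * (c * M_norm L \<phi> e) * M_norm L \<phi> b"
    using W14 order_trans[OF W14]
    by (intro mult_right_mono mult_mono) (auto simp: M_norm_eq L2_norm_nonneg)
  finally show "\<bar>e \<bullet> (S_matrix L \<phi> a *v b)\<bar> \<le> c\<^sup>2 * M_norm L \<phi> a * M_norm L \<phi> b * M_norm L \<phi> e"
    by (simp add: power2_eq_square mult_ac)
qed

lemma L2_norm_fe_diff: "L2_norm (square L) (\<lambda>z. fe a z - fe b z) = M_norm L \<phi> (a - b)"
proof -
  have "fe a z - fe b z = fe (a - b) z" for z
    by (rule linear_diff[OF fe_fun_linear, symmetric])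
  then show ?thesis by (simp add: M_norm_eq)
qed

end

section \<open>Assembling the convergence theorem\<close>

lemma H2_fun_L2_vorticity:
  assumes "H2_fun S u"
  shows "L2_fun S (\<lambda>z. u z - weak_laplacian S u z)"
proof -
  have "L2_fun S u" "L2_fun S (weak_partial S (1, 0) (weak_partial S (1, 0) u))"
    "L2_fun S (weak_partial S (0, 1) (weak_partial S (0, 1) u))"
    using assms by (auto simp: H2_fun_def H1_fun_def Basis_prod_def)
  from L2_fun_lincomb[OF L2_fun_lincomb[OF this(1,2), of "-1"] this(3), of "-1"]
  show ?thesis by (simp add: weak_laplacian_def algebra_simps)
qed

lemma implicit_scheme_elliptic:
  assumes "implicit_scheme L A \<phi> p w \<tau> m U W"
  shows "K_matrix L \<phi> *v U m = mass_matrix L \<phi> *v W m"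
  using assms by (cases m) (auto simp: implicit_scheme_def implicit_step_def)

theorem theorem3p4:
  fixes L T \<tau> h \<epsilon> c0_inv c_inv D1 :: real
    and n m :: nat
    and x y :: "nat \<Rightarrow> real"
    and d :: "nat \<Rightarrow> nat \<Rightarrow> bool"
    and \<T> :: "(real \<times> real) set set"
    and \<nu> :: "'n::finite \<Rightarrow> nat \<times> nat"
    and \<phi> :: "'n \<Rightarrow> real \<times> real \<Rightarrow> real"
    and p u0 w0 :: "real \<times> real \<Rightarrow> real"
    and U W :: "nat \<Rightarrow> real^'n"
    and NU NW :: "nat \<Rightarrow> real^'n"
  assumes "L > 0" and "T > 0"
    and p: "W1inf_fun (square L) p"
    and u0: "H2_fun (square L) u0" "H1_periodic L u0"
    and w0: "w0 = (\<lambda>z. u0 z - weak_laplacian (square L) u0 z)"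
    and grid: "grid_points L n x" "grid_points L n y"
    and triangulation: "\<T> = structured_triangulation n x y d"
    and h: "h = mesh_size \<T>"
    and basis: "nodal_basis L \<T> n x y \<nu> \<phi>"
    and c0_inv: "c0_inv > 0"
      "\<And>v. v \<in> fe_space L \<T> \<Longrightarrow> H1_norm (square L) v \<le> c0_inv / h * L2_norm (square L) v"
    and c_inv: "c_inv > 0"
      "\<And>v. v \<in> fe_space L \<T> \<Longrightarrow>
         W14_seminorm (square L) v \<le> c_inv * h powr (- 5 / 4) * L2_norm (square L) v"
    and time: "real m * \<tau> + \<tau> \<le> T"
    and scheme: "implicit_scheme L \<T> \<phi> p w0 \<tau> m U W"
    and newton: "newton_iterates L \<phi> p \<tau> (U m) (W m) NU NW"
    and "\<epsilon> > 0"
    and tol: "\<exists>k0. \<forall>k\<ge>k0.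
      L2_norm (square L) (\<lambda>z. fe_fun \<phi> (NU (Suc k)) z - fe_fun \<phi> (NU k) z) < \<epsilon>"
    and D1: "D1 = c_inv\<^sup>2 * (\<epsilon> + exp (3 * T * W1inf_norm (square L) p) * L2_norm (square L) w0)
      + 2 * W1inf_norm (square L) p"
    and "h < 1"
    and "0 < \<tau>"
    \<comment> \<open>In \<open>ereal\<close>, \<open>a / 0 = \<infinity>\<close> for \<open>a > 0\<close>.\<close>
    and "ereal \<tau> \<le> Min {1 / ereal (6 * W1inf_norm (square L) p),
      ereal (h\<^sup>2) / ereal (16 * c0_inv * M_norm L \<phi> (W m)),
      ereal (h powr (5 / 2)) / ereal (2 * D1)}"
  shows "\<exists>U' W'. implicit_step L \<phi> p \<tau> (U m) (W m) U' W' \<and>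
    (\<forall>U'' W''. implicit_step L \<phi> p \<tau> (U m) (W m) U'' W'' \<longrightarrow> U'' = U' \<and> W'' = W') \<and>
    (\<lambda>k. L2_norm (square L) (\<lambda>z. fe_fun \<phi> (NU k) z - fe_fun \<phi> U' z)) \<longlonglongrightarrow> 0 \<and>
    (\<lambda>k. L2_norm (square L) (\<lambda>z. fe_fun \<phi> (NW k) z - fe_fun \<phi> W' z)) \<longlonglongrightarrow> 0"
proof -
  interpret fe_discretization L n x y d \<nu> \<phi>
    using \<open>L > 0\<close> grid basis unfolding triangulation by unfold_locales
  note \<T> = triangulation
  \<comment> \<open>Two inverse estimates with \<open>h powr (- 5 / 4)\<close> give \<open>C\<close>
    the power \<open>h powr (- 5 / 2)\<close>. \<open>E\<close> is the a priori L2 bound for the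
    vorticity up to time \<open>T\<close>.\<close>
  define P C c E where "P = W1inf_norm (square L) p" and "C = c\<^sup>2" and "c = c_inv * h powr (- 5 / 4)"
    and "E = exp (3 * T * P) * L2_norm (square L) w0"
  interpret discrete_scheme L \<phi> p P C
    unfolding P_def C_def using c_inv(2) unfolding c_def \<T> by (intro fe_discrete_scheme[OF p]) auto
  have E_nonneg: "0 \<le> E" by (simp add: E_def L2_norm_nonneg)
  have D1_eq: "D1 = c_inv\<^sup>2 * (\<epsilon> + E) + 2 * P" by (simp add: D1 E_def P_def)
  have D1_pos: "0 < D1"
    unfolding D1_eq using \<open>\<epsilon> > 0\<close> c_inv(1) E_nonneg P_nonneg by (intro add_pos_nonneg mult_pos_pos) auto
  have min: "ereal \<tau> \<le> 1 / ereal (6 * P)" "ereal \<tau> \<le> ereal (h powr (5 / 2)) / ereal (2 * D1)"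
    using \<open>ereal \<tau> \<le> Min _\<close> by (simp_all add: P_def)
  \<comment> \<open>For \<open>P = 0\<close> the quotient is infinite, and the claim reads
    \<open>0 \<le> 1\<close>.\<close>
  have tau_P: "6 * (\<tau> * P) \<le> 1"
    using min(1) P_nonneg by (cases "P = 0") (auto simp: one_ereal_def field_simps)
  have tau_h: "\<tau> * D1 \<le> h powr (5 / 2) / 2"
    using min(2) D1_pos by (simp add: field_simps)
  have "0 \<le> h" using mesh_size_nonneg by (simp add: h \<T>)
  \<comment> \<open>Since \<open>0 powr (5 / 2)\<close> is 0, a vanishing mesh size would leave no
    room for a positive \<open>\<tau>\<close>.\<close>
  have "h \<noteq> 0"
  proof
    assume "h = 0"
    then have "\<tau> * D1 \<le> 0" using tau_h by simp
    then show False using \<open>0 < \<tau>\<close> D1_pos by (simp add: mult_le_0_iff)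
  qed
  with \<open>0 \<le> h\<close> have "0 < h" by simp
  have C_eq: "C = c_inv\<^sup>2 * h powr (- 5 / 2)"
    by (simp add: C_def c_def power_mult_distrib power2_eq_square[of "h powr _"] flip: powr_add)
  \<comment> \<open>Here \<open>h < 1\<close> enters: the term \<open>2 * P\<close> comes without a
    power of \<open>h\<close>, and enlarging it by \<open>h powr (- 5 / 2)\<close> bounds the whole
    sum by a multiple of \<open>D1\<close>.\<close>
  have "1 \<le> h powr (- 5 / 2)" using \<open>0 < h\<close> \<open>h < 1\<close> by (simp add: powr_minus powr_le1 one_le_inverse)
  then have "2 * P \<le> h powr (- 5 / 2) * (2 * P)" using P_nonneg by (simp add: mult_le_cancel_right1)
  then have "\<tau> * (2 * P + C * E + C * \<epsilon>) \<le> \<tau> * (h powr (- 5 / 2) * D1)"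
    using \<open>0 < \<tau>\<close> unfolding C_eq D1_eq by (intro mult_left_mono) (simp_all add: algebra_simps)
  also have "\<dots> \<le> h powr (- 5 / 2) * (h powr (5 / 2) / 2)"
    using mult_left_mono[OF tau_h, of "h powr (- 5 / 2)"] by (simp add: mult_ac)
  also have "\<dots> = 1 / 2" using \<open>0 < h\<close> by (simp flip: powr_add)
  finally have small: "\<tau> * (2 * P + C * E + C * \<epsilon>) \<le> 1 / 2" .
  have elliptic: "K *v U m = M *v W m" using scheme by (rule implicit_scheme_elliptic)
  have "2 * (\<tau> * P) < 1" using tau_P by linarith
  then obtain U' W' where exact: "implicit_step L \<phi> p \<tau> (U m) (W m) U' W'"
    using implicit_step_exists[OF elliptic \<open>0 < \<tau>\<close>] by blast
  have "N W' \<le> E"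
  proof -
    have "L2_norm (square L) (fe (W 0)) \<le> L2_norm (square L) w0"
      using scheme u0(1) by (intro L2_projection_norm_le)
        (auto simp: implicit_scheme_def \<T> w0 H2_fun_L2_vorticity)
    then have W0: "N (W 0) \<le> L2_norm (square L) w0" by (simp add: M_norm_eq)
    \<comment> \<open>The exponents of the \<open>m\<close> past steps and of the current one add up
      to the time \<open>m * \<tau> + \<tau>\<close>, which is at most \<open>T\<close>.\<close>
    have "N W' \<le> exp (3 * (\<tau> * P)) * N (W m)"
      by (rule implicit_step_exp[OF exact \<open>0 < \<tau>\<close> tau_P])
    also have "\<dots> \<le> exp (3 * (\<tau> * P)) * (exp (3 * (real m * \<tau> * P)) * N (W 0))"
      using scheme \<open>0 < \<tau>\<close> tau_P
      by (intro mult_left_mono implicit_scheme_bound) (auto simp: implicit_scheme_def)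
    also have "\<dots> = exp (3 * ((real m * \<tau> + \<tau>) * P)) * N (W 0)"
      by (simp add: algebra_simps flip: exp_add)
    also have "\<dots> \<le> exp (3 * (T * P)) * L2_norm (square L) w0"
      using W0 N_nonneg[of "W 0"] mult_right_mono[OF time P_nonneg] by (intro mult_mono) auto
    finally show ?thesis by (simp add: E_def mult_ac)
  qed
  then have "\<tau> * (2 * P + C * N W' + C * \<epsilon>) \<le> \<tau> * (2 * P + C * E + C * \<epsilon>)"
    using \<open>0 < \<tau>\<close> C_nonneg by (intro mult_left_mono add_mono) auto
  with small have small': "\<tau> * (2 * P + C * N W' + C * \<epsilon>) \<le> 1 / 2" by linarith
  have "\<tau> * (C * \<epsilon>) \<ge> 0" using \<open>0 < \<tau>\<close> \<open>\<epsilon> > 0\<close> C_nonneg by simp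
  with small' have unique: "\<tau> * (2 * P + C * N W') < 1" by (simp add: algebra_simps)
  obtain k0 where k0: "\<And>k. k \<ge> k0 \<Longrightarrow> N (NU (Suc k) - NU k) \<le> \<epsilon>"
    using tol unfolding L2_norm_fe_diff by (auto intro: less_imp_le)
  note converges = newton_converges[OF exact newton \<open>0 < \<tau>\<close> small' k0]
  show ?thesis
    unfolding L2_norm_fe_diff
    using exact implicit_step_unique[OF exact _ \<open>0 < \<tau>\<close> unique] converges by blast
qed

end
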